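(* Let $(M,\omega)$ be a symplectic manifold, $U\subseteq M$ an open subset, and $X\subseteq U$ a compact subset. Then $$\operatorname{Diam}(U,M,\omega)\ \ge\ \operatorname{diam}(X,M,\omega).$$
   Context: All manifolds are smooth with empty boundary. For a time-dependent vector field $V:[0,1]\times M\to TM$ let $\mathcal{D}_V^t$ be the set of $x_0\in M$ for which $\dot x(s)=V(s,x(s))$, $x(0)=x_0$ has a solution $x\in C^\infty([0,t],M)$, and put $\varphi_V^t(x_0):=x(t)$ on $\mathcal{D}_V^t$. For $H\in C^\infty([0,1]\times M,\mathbb{R})$, $H^t:=H(t,\cdot)$, the Hamiltonian vector field is given by $\omega(X_{H^t},\cdot)=dH^t$, and $\varphi_H^t:=\varphi_{X_H}^t$. For a closed subset $X\subseteq M$, $V$ is called $X$-compatible iff $X\subseteq\mathcal{D}_V^1$ and $\varphi_V^t(X)=X$ for every $t\in[0,1]$. Define $\mathcal{H}(M,\omega,X):=\{H\in C^\infty([0,1]\times M,\mathbb{R})\mid X_H \text{ is } X\text{-compatible}\}$, $\mathcal{H}(M,\omega):=\mathcal{H}(M,\omega,M)$, and $\operatorname{Ham}(X,\omega):=\{\varphi_H^1|_X\mid H\in\mathcal{H}(M,\omega,X)\}$. Put $\Vert H\Vert_X:=\int_0^1\big(\sup_X H^t-\inf_X H^t\big)dt\in[0,\infty]$ and, for $\varphi\in\operatorname{Ham}(X,\omega)$, $\Vert\varphi\Vert^{X,\omega}:=\inf\{\Vert H\Vert_X\mid H\in\mathcal{H}(M,\omega,X),\ \varphi_H^1|_X=\varphi\}$;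 in particular this defines $\Vert\cdot\Vert^{M,\omega}$ on $\operatorname{Ham}(M,\omega)$. For $\varphi\in\operatorname{Ham}(X,\omega)$ put $\Vert\varphi\Vert_X^{M,\omega}:=\inf\{\Vert\psi\Vert^{M,\omega}\mid\psi\in\operatorname{Ham}(M,\omega),\ \psi|_X=\varphi\}$ (with $\inf\emptyset=\infty$), and $\operatorname{diam}(X,M,\omega):=\sup\{\Vert\varphi\Vert_X^{M,\omega}\mid\varphi\in\operatorname{Ham}(X,\omega)\}$. For an open subset $U\subseteq M$, $\operatorname{Diam}(U,M,\omega):=\sup\{\Vert\varphi_H^1\Vert^{M,\omega}\mid H\in\mathcal{H}(M,\omega),\ \text{support of }H\subseteq[0,1]\times U\}\in[0,\infty]$. *)

theory Defs
  imports "HOL-Analysis.Analysis"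
begin

text \<open>Model spaces of charts: finite-dimensional real inner product spaces. The class
  \<^class>\<open>euclidean_space\<close> would exclude dimension \<open>0\<close>; the superclasses
  \<^class>\<open>banach\<close> and \<^class>\<open>heine_borel\<close> impose no restriction, as every
  finite-dimensional inner product space is complete and has the Heine-Borel property.\<close>

class findim_inner = real_inner + banach + heine_borel +
  assumes finite_dimensional: "\<exists>B. finite B \<and> (\<forall>x. \<exists>a. x = (\<Sum>b\<in>B. a b *\<^sub>R b))"

instance euclidean_space \<subseteq> findim_inner
  by standard (metis euclidean_representation finite_Basis)


text \<open>\<open>C\<^sup>k\<close> and \<open>C\<^sup>\<infinity>\<close> maps on an open subset of a finite-dimensional space.\<close>

primrec Ck_on :: "nat \<Rightarrow> 'v::real_normed_vector set \<Rightarrow> ('v \<Rightarrow> 'w::real_normed_vector) \<Rightarrow> bool" where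
  "Ck_on 0 S f \<longleftrightarrow> continuous_on S f"
| "Ck_on (Suc k) S f \<longleftrightarrow> (\<forall>x\<in>S. f differentiable (at x)) \<and>
     (\<forall>v. Ck_on k S (\<lambda>x. frechet_derivative f (at x) v))"

definition Cinf_on :: "'v::real_normed_vector set \<Rightarrow> ('v \<Rightarrow> 'w::real_normed_vector) \<Rightarrow> bool" where
  "Cinf_on S f \<longleftrightarrow> (\<forall>k. Ck_on k S f)"

text \<open>Smoothness on an arbitrary subset such as \<open>[0,1] \<times> V\<close>: local extendability to a smooth
  map on an open neighbourhood.\<close>

definition smooth_on :: "'v::real_normed_vector set \<Rightarrow> ('v \<Rightarrow> 'w::real_normed_vector) \<Rightarrow> bool" where
  "smooth_on S f \<longleftrightarrow>
     (\<forall>p\<in>S. \<exists>W g. open W \<and> p \<in> W \<and> Cinf_on W g \<and> (\<forall>q\<in>W \<inter> S. g q = f q))"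


text \<open>A chart is a pair of its domain and its coordinate map; the values of the coordinate map
  off the domain are irrelevant.\<close>

type_synonym ('a, 'e) chart = "'a set \<times> ('a \<Rightarrow> 'e)"

abbreviation cdom :: "('a, 'e) chart \<Rightarrow> 'a set" where "cdom c \<equiv> fst c"
abbreviation cmap :: "('a, 'e) chart \<Rightarrow> 'a \<Rightarrow> 'e" where "cmap c \<equiv> snd c"
abbreviation cimg :: "('a, 'e) chart \<Rightarrow> 'e set" where "cimg c \<equiv> snd c ` fst c"
abbreviation cinv :: "('a, 'e) chart \<Rightarrow> 'e \<Rightarrow> 'a" where "cinv c \<equiv> inv_into (fst c) (snd c)"

definition is_chart :: "('a::topological_space, 'e::topological_space) chart \<Rightarrow> bool" where
  "is_chart c \<longleftrightarrow> open (cdom c) \<and> open (cimg c) \<and>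
     homeomorphism (cdom c) (cimg c) (cmap c) (cinv c)"

definition transition :: "('a, 'e) chart \<Rightarrow> ('a, 'e) chart \<Rightarrow> 'e \<Rightarrow> 'e" where
  "transition c d = cmap d \<circ> cinv c"

text \<open>The underlying set of the manifold is the whole type \<open>'a\<close>.\<close>

definition smooth_manifold ::
  "('a::{t2_space,second_countable_topology}, 'e::findim_inner) chart set \<Rightarrow> bool" where
  "smooth_manifold A \<longleftrightarrow> (\<forall>c\<in>A. is_chart c) \<and> (\<Union>c\<in>A. cdom c) = UNIV \<and>
     (\<forall>c\<in>A. \<forall>d\<in>A. Cinf_on (cmap c ` (cdom c \<inter> cdom d)) (transition c d))"


text \<open>A tangent vector at \<open>p\<close> is the family of its coordinate vectors in all charts of the
  atlas around \<open>p\<close>, related by the derivatives of the transition maps; it is normalised to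
  \<open>0\<close> at all other pairs, so that equality of tangent vectors is equality of functions.\<close>

type_synonym ('a, 'e) tvec = "('a, 'e) chart \<Rightarrow> 'e"

definition tangent_space ::
  "('a, 'e::real_normed_vector) chart set \<Rightarrow> 'a \<Rightarrow> ('a, 'e) tvec set" where
  "tangent_space A p = {v.
     (\<forall>c\<in>A. \<forall>d\<in>A. p \<in> cdom c \<longrightarrow> p \<in> cdom d \<longrightarrow>
        v d = frechet_derivative (transition c d) (at (cmap c p)) (v c)) \<and>
     (\<forall>c. c \<notin> A \<or> p \<notin> cdom c \<longrightarrow> v c = 0)}"

text \<open>The tangent vector at \<open>p\<close> whose coordinate vector in the chart \<open>c\<close> is \<open>u\<close>.\<close>

definition tangent_of ::
  "('a, 'e::real_normed_vector) chart set \<Rightarrow> ('a, 'e) chart \<Rightarrow> 'a \<Rightarrow> 'e \<Rightarrow> ('a, 'e) tvec" where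
  "tangent_of A c p u = (\<lambda>d. if d \<in> A \<and> p \<in> cdom d
     then frechet_derivative (transition c d) (at (cmap c p)) u else 0)"

text \<open>The value does not depend on the chart chosen around \<open>p\<close>.\<close>

definition differential ::
  "('a, 'e::real_normed_vector) chart set \<Rightarrow> ('a \<Rightarrow> real) \<Rightarrow> 'a \<Rightarrow> ('a, 'e) tvec \<Rightarrow> real" where
  "differential A f p v = (let c = (SOME c. c \<in> A \<and> p \<in> cdom c) in
     frechet_derivative (f \<circ> cinv c) (at (cmap c p)) (v c))"


type_synonym ('a, 'e) two_form = "'a \<Rightarrow> ('a, 'e) tvec \<Rightarrow> ('a, 'e) tvec \<Rightarrow> real"

definition form_coord :: "('a, 'e::real_normed_vector) chart set \<Rightarrow> ('a, 'e) two_form \<Rightarrow>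
    ('a, 'e) chart \<Rightarrow> 'e \<Rightarrow> 'e \<Rightarrow> 'e \<Rightarrow> real" where
  "form_coord A \<omega> c u v y =
     \<omega> (cinv c y) (tangent_of A c (cinv c y) u) (tangent_of A c (cinv c y) v)"

definition smooth_two_form ::
  "('a, 'e::real_normed_vector) chart set \<Rightarrow> ('a, 'e) two_form \<Rightarrow> bool" where
  "smooth_two_form A \<omega> \<longleftrightarrow>
     (\<forall>p. \<forall>v\<in>tangent_space A p. \<forall>w\<in>tangent_space A p. \<forall>z\<in>tangent_space A p. \<forall>a.
        \<omega> p (\<lambda>c. a *\<^sub>R v c + w c) z = a * \<omega> p v z + \<omega> p w z \<and>
        \<omega> p z (\<lambda>c. a *\<^sub>R v c + w c) = a * \<omega> p z v + \<omega> p z w) \<and>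
     (\<forall>p. \<forall>v\<in>tangent_space A p. \<omega> p v v = 0) \<and>
     (\<forall>c\<in>A. \<forall>u v. Cinf_on (cimg c) (form_coord A \<omega> c u v))"

text \<open>\<open>d\<omega> = 0\<close>, with \<open>d\<omega>\<close> evaluated on constant vector fields in each chart.\<close>

definition closed_two_form ::
  "('a, 'e::real_normed_vector) chart set \<Rightarrow> ('a, 'e) two_form \<Rightarrow> bool" where
  "closed_two_form A \<omega> \<longleftrightarrow> (\<forall>c\<in>A. \<forall>y\<in>cimg c. \<forall>u v w.
     frechet_derivative (form_coord A \<omega> c v w) (at y) u
     - frechet_derivative (form_coord A \<omega> c u w) (at y) v
     + frechet_derivative (form_coord A \<omega> c u v) (at y) w = 0)"

definition nondegenerate_two_form ::
  "('a, 'e::real_normed_vector) chart set \<Rightarrow> ('a, 'e) two_form \<Rightarrow> bool" where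
  "nondegenerate_two_form A \<omega> \<longleftrightarrow> (\<forall>p. \<forall>v\<in>tangent_space A p.
     (\<forall>w\<in>tangent_space A p. \<omega> p v w = 0) \<longrightarrow> v = (\<lambda>_. 0))"

definition symplectic_manifold ::
  "('a::{t2_space,second_countable_topology}, 'e::findim_inner) chart set \<Rightarrow>
    ('a, 'e) two_form \<Rightarrow> bool" where
  "symplectic_manifold A \<omega> \<longleftrightarrow> smooth_manifold A \<and>
     smooth_two_form A \<omega> \<and> closed_two_form A \<omega> \<and> nondegenerate_two_form A \<omega>"


definition smooth_curve :: "('a::topological_space, 'e::real_normed_vector) chart set \<Rightarrow>
    real set \<Rightarrow> (real \<Rightarrow> 'a) \<Rightarrow> bool" where
  "smooth_curve A I x \<longleftrightarrow> continuous_on I x \<and>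
     (\<forall>c\<in>A. smooth_on {s\<in>I. x s \<in> cdom c} (cmap c \<circ> x))"

text \<open>\<open>x \<in> C\<^sup>\<infinity>([0,t], M)\<close> solves \<open>x' = V(s, x)\<close>, \<open>x(0) = x0\<close>; the equation is read in every
  chart. Time-dependent objects are functions on all of \<open>\<real>\<close> of which only the values at times
  in \<open>[0,1]\<close> are ever used.\<close>

definition is_solution :: "('a::topological_space, 'e::real_normed_vector) chart set \<Rightarrow>
    (real \<Rightarrow> 'a \<Rightarrow> ('a, 'e) tvec) \<Rightarrow> real \<Rightarrow> 'a \<Rightarrow> (real \<Rightarrow> 'a) \<Rightarrow> bool" where
  "is_solution A V t x0 x \<longleftrightarrow> smooth_curve A {0..t} x \<and> x 0 = x0 \<and>
     (\<forall>s\<in>{0..t}. \<forall>c\<in>A. x s \<in> cdom c \<longrightarrow>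
        ((cmap c \<circ> x) has_vector_derivative V s (x s) c) (at s within {0..t}))"

definition flow_domain :: "('a::topological_space, 'e::real_normed_vector) chart set \<Rightarrow>
    (real \<Rightarrow> 'a \<Rightarrow> ('a, 'e) tvec) \<Rightarrow> real \<Rightarrow> 'a set" where
  "flow_domain A V t = {x0. \<exists>x. is_solution A V t x0 x}"

definition flow :: "('a::topological_space, 'e::real_normed_vector) chart set \<Rightarrow>
    (real \<Rightarrow> 'a \<Rightarrow> ('a, 'e) tvec) \<Rightarrow> real \<Rightarrow> 'a \<Rightarrow> 'a" where
  "flow A V t x0 = (THE y. \<exists>x. is_solution A V t x0 x \<and> y = x t)"

definition compatible :: "('a::topological_space, 'e::real_normed_vector) chart set \<Rightarrow>
    'a set \<Rightarrow> (real \<Rightarrow> 'a \<Rightarrow> ('a, 'e) tvec) \<Rightarrow> bool" where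
  "compatible A X V \<longleftrightarrow> X \<subseteq> flow_domain A V 1 \<and> (\<forall>t\<in>{0..1}. flow A V t ` X = X)"


definition hamiltonian_vf :: "('a, 'e::real_normed_vector) chart set \<Rightarrow> ('a, 'e) two_form \<Rightarrow>
    ('a \<Rightarrow> real) \<Rightarrow> 'a \<Rightarrow> ('a, 'e) tvec" where
  "hamiltonian_vf A \<omega> f p = (THE v. v \<in> tangent_space A p \<and>
     (\<forall>w\<in>tangent_space A p. \<omega> p v w = differential A f p w))"

definition smooth_hamiltonian ::
  "('a, 'e::real_normed_vector) chart set \<Rightarrow> (real \<Rightarrow> 'a \<Rightarrow> real) \<Rightarrow> bool" where
  "smooth_hamiltonian A H \<longleftrightarrow>
     (\<forall>c\<in>A. smooth_on ({0..1} \<times> cimg c) (\<lambda>(t, y). H t (cinv c y)))"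

definition hflow :: "('a::topological_space, 'e::real_normed_vector) chart set \<Rightarrow>
    ('a, 'e) two_form \<Rightarrow> (real \<Rightarrow> 'a \<Rightarrow> real) \<Rightarrow> real \<Rightarrow> 'a \<Rightarrow> 'a" where
  "hflow A \<omega> H = flow A (\<lambda>t. hamiltonian_vf A \<omega> (H t))"

definition hamiltonians :: "('a::topological_space, 'e::real_normed_vector) chart set \<Rightarrow>
    ('a, 'e) two_form \<Rightarrow> 'a set \<Rightarrow> (real \<Rightarrow> 'a \<Rightarrow> real) set" where
  "hamiltonians A \<omega> X =
     {H. smooth_hamiltonian A H \<and> compatible A X (\<lambda>t. hamiltonian_vf A \<omega> (H t))}"

definition Ham :: "('a::topological_space, 'e::real_normed_vector) chart set \<Rightarrow>
    ('a, 'e) two_form \<Rightarrow> 'a set \<Rightarrow> ('a \<Rightarrow> 'a) set" where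
  "Ham A \<omega> X = {restrict (hflow A \<omega> H 1) X |H. H \<in> hamiltonians A \<omega> X}"

definition hofer_length :: "'a set \<Rightarrow> (real \<Rightarrow> 'a \<Rightarrow> real) \<Rightarrow> ennreal" where
  "hofer_length X H = (\<integral>\<^sup>+t\<in>{0..1}.
     e2ennreal ((SUP x\<in>X. ereal (H t x)) - (INF x\<in>X. ereal (H t x))) \<partial>lborel)"

definition hofer_norm :: "('a::topological_space, 'e::real_normed_vector) chart set \<Rightarrow>
    ('a, 'e) two_form \<Rightarrow> 'a set \<Rightarrow> ('a \<Rightarrow> 'a) \<Rightarrow> ennreal" where
  "hofer_norm A \<omega> X \<phi> =
     Inf {hofer_length X H |H. H \<in> hamiltonians A \<omega> X \<and> restrict (hflow A \<omega> H 1) X = \<phi>}"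

definition rel_hofer_norm :: "('a::topological_space, 'e::real_normed_vector) chart set \<Rightarrow>
    ('a, 'e) two_form \<Rightarrow> 'a set \<Rightarrow> ('a \<Rightarrow> 'a) \<Rightarrow> ennreal" where
  "rel_hofer_norm A \<omega> X \<phi> =
     Inf {hofer_norm A \<omega> UNIV \<psi> |\<psi>. \<psi> \<in> Ham A \<omega> UNIV \<and> restrict \<psi> X = \<phi>}"

definition rel_diam :: "('a::topological_space, 'e::real_normed_vector) chart set \<Rightarrow>
    ('a, 'e) two_form \<Rightarrow> 'a set \<Rightarrow> ennreal" where
  "rel_diam A \<omega> X = Sup {rel_hofer_norm A \<omega> X \<phi> |\<phi>. \<phi> \<in> Ham A \<omega> X}"

definition ham_support :: "(real \<Rightarrow> 'a::topological_space \<Rightarrow> real) \<Rightarrow> (real \<times> 'a) set" where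
  "ham_support H = closure {(t, x). t \<in> {0..1} \<and> H t x \<noteq> 0}"

definition open_diam :: "('a::topological_space, 'e::real_normed_vector) chart set \<Rightarrow>
    ('a, 'e) two_form \<Rightarrow> 'a set \<Rightarrow> ennreal" where
  "open_diam A \<omega> U = Sup {hofer_norm A \<omega> UNIV (hflow A \<omega> H 1) |H.
     H \<in> hamiltonians A \<omega> UNIV \<and> ham_support H \<subseteq> {0..1} \<times> U}"

end

theory Submission
  imports Defs
begin

text \<open>Given \<open>H\<close> generating \<open>\<phi>\<close> on \<open>X\<close>, multiply it by a cutoff function \<open>\<rho>\<close> with compact support
  in \<open>U\<close> that equals \<open>1\<close> near \<open>X\<close>. The Hamiltonian vector field of \<open>\<rho> H\<close> has compact support, so it
  is complete. It agrees with that of \<open>H\<close> on \<open>X\<close>, and the \<open>H\<close>-trajectories starting in \<open>X\<close> stay in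
  \<open>X\<close> by compatibility, so by uniqueness of solutions both flows agree on \<open>X\<close>. Hence the flow of
  \<open>\<rho> H\<close> is a competitor in the infimum for \<open>\<phi>\<close> and occurs in the supremum for \<open>U\<close>.\<close>

section \<open>Calculus of smooth maps\<close>

text \<open>No oscillation of a Hamiltonian is ever estimated: both sides of the inequality see the
  Hofer norm of one and the same map, so everything reduces to extending \<open>\<phi>\<close> by a
  Hamiltonian supported in \<open>U\<close>. The weight lies in showing that
  \<open>\<rho> * H\<close> belongs to \<open>hamiltonians A \<omega> UNIV\<close>. Two features of
  the definitions shape this. \<open>hamiltonian_vf\<close> and \<open>flow\<close> are definite
  descriptions, so existence and uniqueness come before any computation: for the field this is
  linear algebra based on nondegeneracy, done with smooth dependence on the point; for the flow it
  is ODE theory in charts. And time runs over the closed interval \<open>{0..1}\<close>, on which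
  smoothness means local extendability, so local arguments are carried out for an extension to an
  open set of times and coordinates and restricted afterwards. Since compatibility with the whole
  manifold asks every time-\<open>t\<close> map to be onto, integral curves are produced from an
  arbitrary initial time, not only from 0.\<close>

lemma frechet_derivative_local:
  assumes "open N" "x \<in> N" "\<And>y. y \<in> N \<Longrightarrow> f y = g y"
  shows "frechet_derivative f (at x) = frechet_derivative g (at x)"
proof -
  have "(f has_derivative D) (at x) \<longleftrightarrow> (g has_derivative D) (at x)" for D
    using has_derivative_transform_within_open[OF _ assms(1,2)] assms(3) by metis
  then show ?thesis by (simp add: frechet_derivative_def)
qed

text \<open>Openness of \<open>S\<close> enters because \<open>Ck_on\<close> uses full derivatives,
  which see a neighbourhood of each point; equality on an open set therefore passes to the
  derivatives and the induction continues.\<close>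

lemma Ck_on_cong_imp:
  assumes "open S" "\<And>x. x \<in> S \<Longrightarrow> f x = g x" "Ck_on k S f"
  shows "Ck_on k S g"
  using assms(2,3)
proof (induction k arbitrary: f g)
  case 0
  then show ?case by (auto cong: continuous_on_cong)
next
  case (Suc k)
  have d: "g differentiable (at x) \<and> frechet_derivative g (at x) = frechet_derivative f (at x)"
    if "x \<in> S" for x
  proof -
    have "f differentiable (at x)" using Suc.prems(2) that by simp
    then have "(f has_derivative frechet_derivative f (at x)) (at x)"
      by (simp add: frechet_derivative_works[symmetric])
    then have "(g has_derivative frechet_derivative f (at x)) (at x)"
      using has_derivative_transform_within_open[OF _ assms(1) that] Suc.prems(1) by blast
    then show ?thesis
      by (metis differentiableI frechet_derivative_at)
  qed
  have "Ck_on k S (\<lambda>x. frechet_derivative g (at x) v)" for v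
    by (rule Suc.IH[of "\<lambda>x. frechet_derivative f (at x) v"]) (use d Suc.prems(2) in auto)
  then show ?case using d by simp
qed

text \<open>Lets an explicit derivative \<open>f'\<close> stand in for
  \<open>frechet_derivative\<close>, which is a choice operator. The closure properties below then
  reduce to a differentiation rule together with the induction hypothesis for
  \<open>f'\<close>.\<close>

lemma Ck_on_SucI:
  assumes "open S" "\<And>x. x \<in> S \<Longrightarrow> (f has_derivative f' x) (at x)"
    "\<And>v. Ck_on k S (\<lambda>x. f' x v)"
  shows "Ck_on (Suc k) S f"
proof -
  have "Ck_on k S (\<lambda>x. frechet_derivative f (at x) v)" for v
    by (rule Ck_on_cong_imp[OF assms(1) _ assms(3)[of v]]) (metis assms(2) frechet_derivative_at)
  then show ?thesis using assms(2) by (auto simp: differentiable_def)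
qed

lemma Ck_on_Suc_has_derivative:
  assumes "Ck_on (Suc k) S f" "x \<in> S"
  shows "(f has_derivative frechet_derivative f (at x)) (at x)"
  using assms by (auto simp: frechet_derivative_works[symmetric])

lemma Ck_on_SucD: "Ck_on (Suc k) S f \<Longrightarrow> Ck_on k S f"
proof (induction k arbitrary: f)
  case 0
  then show ?case
    by (auto intro!: continuous_at_imp_continuous_on differentiable_imp_continuous_within)
next
  case (Suc k)
  then show ?case by (auto simp del: Ck_on.simps(1))
qed

lemma Ck_on_continuous_on: "Ck_on k S f \<Longrightarrow> continuous_on S f"
  by (induction k) (auto dest: Ck_on_SucD simp del: Ck_on.simps(2))

lemma Ck_on_subset: "Ck_on k S f \<Longrightarrow> T \<subseteq> S \<Longrightarrow> Ck_on k T f"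
  by (induction k arbitrary: f) (auto intro: continuous_on_subset)

lemma Ck_on_local:
  assumes "\<And>x. x \<in> S \<Longrightarrow> \<exists>W. open W \<and> x \<in> W \<and> Ck_on k W f"
  shows "Ck_on k S f"
  using assms
proof (induction k arbitrary: f)
  case 0
  then show ?case
    by (metis Ck_on.simps(1) continuous_at_imp_continuous_on continuous_on_eq_continuous_at)
next
  case (Suc k)
  have "f differentiable (at x)" if "x \<in> S" for x
    using Suc.prems[OF that] by auto
  moreover have "Ck_on k S (\<lambda>x. frechet_derivative f (at x) v)" for v
  proof (rule Suc.IH)
    fix x assume "x \<in> S"
    then obtain W where "open W" "x \<in> W" "Ck_on (Suc k) W f" using Suc.prems by blast
    then show "\<exists>W. open W \<and> x \<in> W \<and> Ck_on k W (\<lambda>x. frechet_derivative f (at x) v)" by auto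
  qed
  ultimately show ?case by simp
qed

lemma Ck_on_const [intro]: "open S \<Longrightarrow> Ck_on k S (\<lambda>x. c)"
proof (induction k arbitrary: c)
  case (Suc k)
  then show ?case by (intro Ck_on_SucI[where f'="\<lambda>x v. 0"]) auto
qed auto

lemma Ck_on_bounded_linear:
  assumes "bounded_linear h" "open S" "Ck_on k S f"
  shows "Ck_on k S (\<lambda>x. h (f x))"
  using assms(3)
proof (induction k arbitrary: f)
  case 0
  then show ?case using assms(1) by (auto intro: bounded_linear.continuous_on)
next
  case (Suc k)
  show ?case
    by (rule Ck_on_SucI[OF assms(2) bounded_linear.has_derivative[OF assms(1) Ck_on_Suc_has_derivative[OF Suc.prems]]])
      (use Suc in auto)
qed

lemma Ck_on_ident: "open S \<Longrightarrow> Ck_on k S (\<lambda>x. x)"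
  by (cases k) (auto simp del: Ck_on.simps(2) intro!: Ck_on_SucI[where f'="\<lambda>x v. v"])

lemma Ck_on_add:
  assumes "open S" "Ck_on k S f" "Ck_on k S g"
  shows "Ck_on k S (\<lambda>x. f x + g x)"
  using assms(2,3)
proof (induction k arbitrary: f g)
  case 0
  then show ?case by (auto intro: continuous_intros)
next
  case (Suc k)
  show ?case
    by (rule Ck_on_SucI[OF assms(1) has_derivative_add[OF Ck_on_Suc_has_derivative[OF Suc.prems(1)]
      Ck_on_Suc_has_derivative[OF Suc.prems(2)]]])
      (use Suc in auto)
qed

lemma Ck_on_sum:
  assumes "open S" "\<And>i. i \<in> I \<Longrightarrow> Ck_on k S (f i)"
  shows "Ck_on k S (\<lambda>x. \<Sum>i\<in>I. f i x)"
  using assms(2) by (induction I rule: infinite_finite_induct) (auto intro: Ck_on_add Ck_on_const assms(1))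

lemma Ck_on_bilinear:
  assumes "bounded_bilinear h" "open S" "Ck_on k S f" "Ck_on k S g"
  shows "Ck_on k S (\<lambda>x. h (f x) (g x))"
  using assms(3,4)
proof (induction k arbitrary: f g)
  case 0
  then show ?case using assms(1) by (auto intro: bounded_bilinear.continuous_on)
next
  case (Suc k)
  have "Ck_on k S (\<lambda>x. h (f x) (frechet_derivative g (at x) v) + h (frechet_derivative f (at x) v) (g x))" for v
    by (intro Ck_on_add assms(2) Suc.IH) (use Suc.prems in \<open>auto simp del: Ck_on.simps intro: Ck_on_SucD\<close>, use Suc.prems in auto)
  then show ?case
    by (intro Ck_on_SucI[OF assms(2) bounded_bilinear.FDERIV[OF assms(1) Ck_on_Suc_has_derivative[OF Suc.prems(1)]
      Ck_on_Suc_has_derivative[OF Suc.prems(2)]]])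
qed

lemmas Ck_on_scaleR = Ck_on_bilinear[OF bounded_bilinear_scaleR]

lemma Ck_on_Pair:
  assumes S: "open S" and "Ck_on k S f" "Ck_on k S g"
  shows "Ck_on k S (\<lambda>x. (f x, g x))"
proof -
  have 1: "bounded_linear (\<lambda>a. (a, 0))" and 2: "bounded_linear (\<lambda>b. (0, b))"
    by (intro bounded_linear_Pair bounded_linear_ident bounded_linear_zero)+
  have "Ck_on k S (\<lambda>x. (f x, 0) + (0, g x))"
    by (intro Ck_on_add S Ck_on_bounded_linear[OF 1] Ck_on_bounded_linear[OF 2] assms)
  then show ?thesis by simp
qed

lemma Cinf_on_derivative: "Cinf_on S f \<Longrightarrow> Cinf_on S (\<lambda>x. frechet_derivative f (at x) v)"
  unfolding Cinf_on_def by (metis Ck_on.simps(2))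

lemma Cinf_on_has_derivative:
  "Cinf_on S f \<Longrightarrow> x \<in> S \<Longrightarrow> (f has_derivative frechet_derivative f (at x)) (at x)"
  unfolding Cinf_on_def by (metis Ck_on_Suc_has_derivative)

lemma Cinf_on_continuous_on: "Cinf_on S f \<Longrightarrow> continuous_on S f"
  unfolding Cinf_on_def by (metis Ck_on.simps(1))

lemma Cinf_on_subset: "Cinf_on S f \<Longrightarrow> T \<subseteq> S \<Longrightarrow> Cinf_on T f"
  unfolding Cinf_on_def by (metis Ck_on_subset)

lemma Cinf_on_cong:
  assumes "open S" "\<And>x. x \<in> S \<Longrightarrow> f x = g x" "Cinf_on S f"
  shows "Cinf_on S g"
  using assms Ck_on_cong_imp unfolding Cinf_on_def by blast

lemma Cinf_on_local:
  assumes "\<And>x. x \<in> S \<Longrightarrow> \<exists>W. open W \<and> x \<in> W \<and> Cinf_on W f"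
  shows "Cinf_on S f"
  using assms Ck_on_local unfolding Cinf_on_def by metis

lemma Cinf_on_const: "open S \<Longrightarrow> Cinf_on S (\<lambda>x. c)"
  unfolding Cinf_on_def by auto

lemma Cinf_on_bilinear:
  assumes "bounded_bilinear h" "open S" "Cinf_on S f" "Cinf_on S g"
  shows "Cinf_on S (\<lambda>x. h (f x) (g x))"
  using Ck_on_bilinear[OF assms(1,2)] assms(3,4) unfolding Cinf_on_def by blast

lemma Cinf_on_add:
  assumes "open S" "Cinf_on S f" "Cinf_on S g"
  shows "Cinf_on S (\<lambda>x. f x + g x)"
  using Ck_on_add[OF assms(1)] assms(2,3) unfolding Cinf_on_def by blast

text \<open>The bump and cutoff functions are built from exactly this shape, which explains terms
  such as \<open>(-1) * ...\<close> and \<open>0 + C * ...\<close> in their formulas.\<close>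

lemma Cinf_on_affine:
  fixes f :: "'v::real_normed_vector \<Rightarrow> real"
  assumes "open S" "Cinf_on S f"
  shows "Cinf_on S (\<lambda>x. a + k * f x)"
  by (intro Cinf_on_add Cinf_on_bilinear[OF bounded_bilinear_mult] Cinf_on_const assms)

lemma Cinf_on_sum:
  assumes "open S" "\<And>i. i \<in> I \<Longrightarrow> Cinf_on S (f i)"
  shows "Cinf_on S (\<lambda>x. \<Sum>i\<in>I. f i x)"
  unfolding Cinf_on_def using assms by (intro allI Ck_on_sum) (auto simp: Cinf_on_def)

section \<open>Finite-dimensional inner product spaces\<close>

text \<open>Orthogonalisation of a spanning set may leave the zero vector behind, so it is removed
  before normalising; the span survives because each remaining vector is a multiple of its
  normalisation.\<close>

lemma exists_orthonormal_basis:
  "\<exists>B::'e::findim_inner set. finite B \<and> (\<forall>b\<in>B. norm b = 1) \<and> (\<forall>b\<in>B. \<forall>c\<in>B. b \<noteq> c \<longrightarrow> b \<bullet> c = 0) \<and> span B = UNIV"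
proof -
  obtain B0 :: "'e set" where B0: "finite B0" "\<forall>x. \<exists>a. x = (\<Sum>b\<in>B0. a b *\<^sub>R b)"
    using finite_dimensional by blast
  have "x \<in> span B0" for x
  proof -
    obtain a where "x = (\<Sum>b\<in>B0. a b *\<^sub>R b)" using B0(2) by blast
    then show ?thesis by (auto intro: span_sum span_scale span_base)
  qed
  then have "span B0 = UNIV" by blast
  moreover obtain C where "finite C" "span C = span B0" "pairwise orthogonal C"
    using basis_orthogonal[OF B0(1)] by blast
  ultimately have C: "finite C" "span C = UNIV" "pairwise orthogonal C" by simp_all
  define B where "B = (\<lambda>b. b /\<^sub>R norm b) ` (C - {0})"
  have "b \<in> span B" if "b \<in> C" for b
  proof (cases "b = 0")
    case False
    have "norm b *\<^sub>R (b /\<^sub>R norm b) \<in> span B"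
      by (rule span_scale, rule span_base) (use that False in \<open>auto simp: B_def\<close>)
    then show ?thesis using False by simp
  qed (simp add: span_zero)
  then have "span B = UNIV"
    using C(2) span_minimal[of C "span B"] by auto
  moreover have "finite B" "\<forall>b\<in>B. norm b = 1" using C by (auto simp: B_def)
  moreover have "\<forall>b\<in>B. \<forall>c\<in>B. b \<noteq> c \<longrightarrow> b \<bullet> c = 0"
    using C(3) unfolding B_def pairwise_def orthogonal_def by auto
  ultimately show ?thesis by blast
qed

text \<open>Replaces the constant \<open>Basis\<close>, which only exists for \<^class>\<open>euclidean_space\<close>.\<close>

definition onb :: "'e::findim_inner set" where
  "onb = (SOME B. finite B \<and> (\<forall>b\<in>B. norm b = 1) \<and> (\<forall>b\<in>B. \<forall>c\<in>B. b \<noteq> c \<longrightarrow> b \<bullet> c = 0) \<and> span B = UNIV)"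

lemma onb_properties:
  "finite (onb :: 'e::findim_inner set) \<and> (\<forall>b\<in>(onb :: 'e set). norm b = 1) \<and>
    (\<forall>b\<in>(onb :: 'e set). \<forall>c\<in>onb. b \<noteq> c \<longrightarrow> b \<bullet> c = 0) \<and> span (onb :: 'e set) = UNIV"
  unfolding onb_def by (rule someI_ex[OF exists_orthonormal_basis])

lemma finite_onb [simp, intro]: "finite (onb :: 'e::findim_inner set)"
  using onb_properties by blast

lemma norm_onb: "b \<in> (onb :: 'e::findim_inner set) \<Longrightarrow> norm b = 1"
  using onb_properties by blast

lemma span_onb: "span (onb :: 'e::findim_inner set) = UNIV"
  using onb_properties by blast

lemma orth_onb: "b \<in> (onb :: 'e::findim_inner set) \<Longrightarrow> c \<in> onb \<Longrightarrow> b \<noteq> c \<Longrightarrow> b \<bullet> c = 0"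
  using onb_properties by blast

lemma onb_inner_zero:
  assumes "\<And>b. b \<in> onb \<Longrightarrow> x \<bullet> b = 0"
  shows "x = (0::'e::findim_inner)"
proof -
  have "orthogonal x x"
    by (rule orthogonal_to_span[of x onb]) (use assms in \<open>auto simp: span_onb orthogonal_def\<close>)
  then show ?thesis by (simp add: orthogonal_def)
qed

lemma onb_inner_sum:
  assumes "b \<in> (onb :: 'e::findim_inner set)"
  shows "(\<Sum>c\<in>onb. a c *\<^sub>R c) \<bullet> b = a b"
proof -
  have "(\<Sum>c\<in>onb. a c *\<^sub>R c) \<bullet> b = (\<Sum>c\<in>onb. if c = b then a c else 0)"
    unfolding inner_sum_left
  proof (rule sum.cong)
    fix c :: 'e assume "c \<in> onb"
    then show "(a c *\<^sub>R c) \<bullet> b = (if c = b then a c else 0)"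
      using assms orth_onb[of c b] norm_onb[of b] by (auto simp: dot_square_norm)
  qed simp
  then show ?thesis using assms by simp
qed

lemma onb_representation: "(\<Sum>b\<in>onb. (x \<bullet> b) *\<^sub>R b) = (x::'e::findim_inner)"
  using onb_inner_zero[of "(\<Sum>b\<in>onb. (x \<bullet> b) *\<^sub>R b) - x"]
  by (simp add: inner_diff_left onb_inner_sum)

text \<open>Replaces a linear map by its finitely many values on \<open>onb\<close>. This is the
  device by which derivatives, which \<open>Ck_on\<close> only controls in fixed directions, are
  handled when the direction itself varies.\<close>

lemma linear_onb:
  assumes "linear (f :: 'e::findim_inner \<Rightarrow> 'w::real_vector)"
  shows "f x = (\<Sum>b\<in>onb. (x \<bullet> b) *\<^sub>R f b)"
proof -
  have "f x = f (\<Sum>b\<in>onb. (x \<bullet> b) *\<^sub>R b)" by (simp add: onb_representation)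
  also have "\<dots> = (\<Sum>b\<in>onb. (x \<bullet> b) *\<^sub>R f b)" by (simp add: linear_sum[OF assms] linear_scale[OF assms])
  finally show ?thesis .
qed

lemma norm_linear_onb_le:
  assumes "linear (f :: 'e::findim_inner \<Rightarrow> 'w::real_normed_vector)"
  shows "norm (f x) \<le> (\<Sum>b\<in>onb. norm (f b)) * norm x"
proof -
  have "norm (f x) \<le> (\<Sum>b\<in>onb. norm ((x \<bullet> b) *\<^sub>R f b))"
    by (subst linear_onb[OF assms]) (rule norm_sum)
  also have "\<dots> \<le> (\<Sum>b\<in>onb. norm (f b) * norm x)"
  proof (rule sum_mono)
    fix b :: 'e assume "b \<in> onb"
    then have "\<bar>x \<bullet> b\<bar> \<le> norm x" using Cauchy_Schwarz_ineq2[of x b] by (simp add: norm_onb)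
    then show "norm ((x \<bullet> b) *\<^sub>R f b) \<le> norm (f b) * norm x"
      by (simp add: mult.commute[of _ "norm (f b)"] mult_left_mono)
  qed
  finally show ?thesis by (simp add: sum_distrib_right)
qed

lemma linear_imp_bounded_linear_findim:
  assumes "linear (f :: 'e::findim_inner \<Rightarrow> 'w::real_normed_vector)"
  shows "bounded_linear f"
  using norm_linear_onb_le[OF assms] assms
  by (intro bounded_linear_intro[where K="\<Sum>b\<in>onb. norm (f b)"])
    (auto simp: linear_add linear_scale mult.commute)

text \<open>Dimension count: the image of \<open>onb\<close> is independent and has as many elements
  as \<open>onb\<close>. A vector outside its span would give an independent set larger than the
  spanning set \<open>onb\<close>.\<close>

lemma linear_inj_imp_surj_findim:
  assumes f: "linear (f :: 'e::findim_inner \<Rightarrow> 'e)" and inj: "\<And>u. f u = 0 \<Longrightarrow> u = 0"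
  shows "\<exists>u. f u = v"
proof -
  have injf: "inj f" using f inj by (simp add: linear_injective_0)
  have "0 \<notin> (onb :: 'e set)" using norm_onb by fastforce
  moreover have "pairwise orthogonal (onb :: 'e set)"
    using orth_onb by (auto simp: pairwise_def orthogonal_def)
  ultimately have "independent (onb :: 'e set)" by (intro pairwise_orthogonal_independent)
  then have ind: "independent (f ` onb)"
    using linear_independent_injective_image[OF f] injf inj_on_subset by blast
  have "v \<in> span (f ` onb)"
  proof (rule ccontr)
    assume v: "v \<notin> span (f ` onb)"
    then have "independent (insert v (f ` onb))" using ind by (intro independent_insertI)
    then have "card (insert v (f ` onb)) \<le> card (onb :: 'e set)"
      using independent_span_bound[OF finite_onb, of "insert v (f ` onb)"] by (simp add: span_onb)
    moreover have "v \<notin> f ` onb" using v span_base[of v "f ` onb"] by auto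
    moreover have "card (f ` onb) = card (onb :: 'e set)"
      using injf by (meson card_image inj_on_subset subset_UNIV)
    ultimately show False by simp
  qed
  then show ?thesis using linear_span_image[OF f, of onb] by (auto simp: span_onb)
qed

text \<open>Time-dependent objects in a chart are functions on \<open>real\<close> times the model
  space, and the chain rule below expands over a basis of the intermediate space.\<close>

instance prod :: (findim_inner, findim_inner) findim_inner
proof
  let ?B = "(\<lambda>b. (b, 0)) ` (onb :: 'a set) \<union> (\<lambda>b. (0, b)) ` (onb :: 'b set)"
  have *: "x \<in> span ?B" for x :: "'a \<times> 'b"
  proof -
    have 1: "(fst x, 0) = (\<Sum>b\<in>onb. (fst x \<bullet> b) *\<^sub>R (b, 0::'b))"
      using linear_onb[of "\<lambda>a. (a, 0::'b)" "fst x"] by (simp add: linear_iff)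
    have 2: "(0, snd x) = (\<Sum>b\<in>onb. (snd x \<bullet> b) *\<^sub>R (0::'a, b))"
      using linear_onb[of "\<lambda>a. (0::'a, a)" "snd x"] by (simp add: linear_iff)
    have "(fst x, 0) \<in> span ?B" "(0, snd x) \<in> span ?B"
      unfolding 1 2 by (intro span_sum span_scale span_base; simp)+
    then have "(fst x, 0) + (0, snd x) \<in> span ?B" by (rule span_add)
    then show ?thesis by simp
  qed
  have "finite ?B" by simp
  moreover have "\<forall>x. \<exists>a. x = (\<Sum>b\<in>?B. a b *\<^sub>R b)"
    using * span_finite[OF \<open>finite ?B\<close>] by blast
  ultimately show "\<exists>B. finite B \<and> (\<forall>x::'a \<times> 'b. \<exists>a. x = (\<Sum>b\<in>B. a b *\<^sub>R b))" by blast
qed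

text \<open>In the chain rule the direction fed to the derivative of \<open>g\<close> depends on
  \<open>x\<close>. Expanding it over \<open>onb\<close> leaves products of coordinate functions of
  the derivative of \<open>f\<close> with derivatives of \<open>g\<close> in fixed directions, to
  which the induction hypothesis applies.\<close>

lemma Ck_on_compose:
  fixes f :: "'a::real_normed_vector \<Rightarrow> 'b::findim_inner" and g :: "'b \<Rightarrow> 'c::real_normed_vector"
  assumes "open S" "f ` S \<subseteq> T" "Ck_on k S f" "Ck_on k T g"
  shows "Ck_on k S (\<lambda>x. g (f x))"
  using assms(3,4)
proof (induction k arbitrary: g)
  case 0
  then show ?case using assms(2) by (auto intro: continuous_on_compose2)
next
  case (Suc k)
  let ?f' = "\<lambda>x. frechet_derivative f (at x)" and ?g' = "\<lambda>y. frechet_derivative g (at y)"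
  have d: "((\<lambda>x. g (f x)) has_derivative (\<lambda>v. \<Sum>b\<in>onb. (?f' x v \<bullet> b) *\<^sub>R ?g' (f x) b)) (at x)"
    if x: "x \<in> S" for x
  proof -
    have g: "(g has_derivative ?g' (f x)) (at (f x))"
      using Ck_on_Suc_has_derivative[OF Suc.prems(2)] assms(2) x by blast
    have "((\<lambda>x. g (f x)) has_derivative (\<lambda>v. ?g' (f x) (?f' x v))) (at x)"
      using has_derivative_compose[OF Ck_on_Suc_has_derivative[OF Suc.prems(1) x] g] .
    moreover have "?g' (f x) (?f' x v) = (\<Sum>b\<in>onb. (?f' x v \<bullet> b) *\<^sub>R ?g' (f x) b)" for v
      by (rule linear_onb[OF has_derivative_linear[OF g]])
    ultimately show ?thesis by (simp only:)
  qed
  have "Ck_on k S (\<lambda>x. \<Sum>b\<in>onb. (?f' x v \<bullet> b) *\<^sub>R ?g' (f x) b)" for v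
  proof (intro Ck_on_sum Ck_on_scaleR assms(1))
    fix b :: 'b
    show "Ck_on k S (\<lambda>x. ?f' x v \<bullet> b)"
      by (rule Ck_on_bounded_linear[OF bounded_linear_inner_left assms(1)]) (use Suc.prems in auto)
    show "Ck_on k S (\<lambda>x. ?g' (f x) b)"
      by (rule Suc.IH[OF Ck_on_SucD[OF Suc.prems(1)]]) (use Suc.prems(2) in auto)
  qed
  with d show ?case by (rule Ck_on_SucI[OF assms(1)])
qed

lemma Cinf_on_compose:
  fixes f :: "'a::real_normed_vector \<Rightarrow> 'b::findim_inner" and g :: "'b \<Rightarrow> 'c::real_normed_vector"
  assumes "open S" "f ` S \<subseteq> T" "Cinf_on S f" "Cinf_on T g"
  shows "Cinf_on S (\<lambda>x. g (f x))"
  using assms Ck_on_compose unfolding Cinf_on_def by metis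

section \<open>Linear systems whose coefficients depend smoothly on a parameter\<close>

text \<open>A product rule for a factor \<open>c\<close> that is merely continuous: since
  \<open>h\<close> vanishes at \<open>x0\<close>, it is of first order there, and the small factor
  \<open>c x - c x0\<close> makes the remaining product of lower order.\<close>

lemma has_derivative_scaleR_vanishing:
  assumes c: "isCont (c :: 'a::real_normed_vector \<Rightarrow> real) x0" and h: "(h has_derivative h') (at x0)"
    and h0: "h x0 = 0"
  shows "((\<lambda>x. c x *\<^sub>R h x) has_derivative (\<lambda>v. c x0 *\<^sub>R h' v)) (at x0)"
proof -
  have bl: "bounded_linear h'" using h by (rule has_derivative_bounded_linear)
  obtain K where K: "K > 0" "\<And>v. norm (h' v) \<le> norm v * K" using bounded_linear.pos_bounded[OF bl] by blast
  have "((\<lambda>x. (c x - c x0) *\<^sub>R h x) has_derivative (\<lambda>v. 0)) (at x0)"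
    unfolding has_derivative_at_alt
  proof (intro conjI allI impI)
    fix e :: real assume e: "e > 0"
    obtain d1 where d1: "d1 > 0" "\<And>y. norm (y - x0) < d1 \<Longrightarrow> norm (h y - h x0 - h' (y - x0)) \<le> 1 * norm (y - x0)"
      using h unfolding has_derivative_at_alt by (metis zero_less_one)
    \<comment> \<open>\<open>1 + K\<close> bounds the growth of \<open>h\<close> near
      \<open>x0\<close>: \<open>K\<close> comes from the derivative, and 1 from the linearisation
      error with tolerance 1.\<close>
    have "e / (1 + K) > 0" using e K by simp
    then obtain d2 where d2: "d2 > 0" "\<And>y. norm (y - x0) < d2 \<Longrightarrow> \<bar>c y - c x0\<bar> < e / (1 + K)"
      using c unfolding continuous_at_eps_delta dist_norm real_norm_def by metis
    show "\<exists>d>0. \<forall>y. norm (y - x0) < d \<longrightarrow>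
        norm ((c y - c x0) *\<^sub>R h y - (c x0 - c x0) *\<^sub>R h x0 - 0) \<le> e * norm (y - x0)"
    proof (intro exI[of _ "min d1 d2"] conjI allI impI)
      fix y assume y: "norm (y - x0) < min d1 d2"
      have "norm (h y) \<le> norm (h' (y - x0)) + norm (h y - h' (y - x0))"
        by (metis norm_triangle_sub add.commute)
      also have "\<dots> \<le> (1 + K) * norm (y - x0)"
        using d1(2)[of y] y K(2)[of "y - x0"] h0 by (simp add: algebra_simps)
      finally have "norm (h y) \<le> (1 + K) * norm (y - x0)" .
      moreover have "\<bar>c y - c x0\<bar> \<le> e / (1 + K)" using d2(2)[of y] y by simp
      ultimately have "\<bar>c y - c x0\<bar> * norm (h y) \<le> e / (1 + K) * ((1 + K) * norm (y - x0))"
        using e K by (intro mult_mono) auto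
      then show "norm ((c y - c x0) *\<^sub>R h y - (c x0 - c x0) *\<^sub>R h x0 - 0) \<le> e * norm (y - x0)"
        using K by simp
    qed (use d1 d2 in auto)
  qed simp
  moreover have "((\<lambda>x. c x0 *\<^sub>R h x) has_derivative (\<lambda>v. c x0 *\<^sub>R h' v)) (at x0)"
    by (rule has_derivative_scaleR_right[OF h])
  ultimately have "((\<lambda>x. (c x - c x0) *\<^sub>R h x + c x0 *\<^sub>R h x) has_derivative (\<lambda>v. 0 + c x0 *\<^sub>R h' v)) (at x0)"
    by (rule has_derivative_add)
  then show ?thesis by (simp add: algebra_simps)
qed

lemma linear_inj_left_inverse_bounded:
  assumes "linear (f :: 'e::findim_inner \<Rightarrow> 'e)" "\<And>u. f u = 0 \<Longrightarrow> u = 0"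
  obtains K where "bounded_linear K" "\<And>u. K (f u) = u"
proof -
  have "inj f" using assms by (simp add: linear_injective_0)
  then obtain K where "linear K" "K \<circ> f = id"
    using linear_injective_left_inverse[OF assms(1)] by blast
  then show ?thesis
    using that linear_imp_bounded_linear_findim by (metis comp_apply id_apply)
qed

text \<open>A perturbation estimate. With a left inverse of \<open>L x0\<close> bounded by
  \<open>C\<close>, the norm of \<open>u\<close> is at most \<open>C\<close> times the norm of
  \<open>L x u\<close> plus \<open>C * \<eta> x\<close> times that of \<open>u\<close>; once
  \<open>\<eta> x < 1 / (2 * C)\<close> the last term is absorbed. Applied to
  \<open>u = F x - F x0\<close>, this gives convergence.\<close>

lemma continuous_on_linear_solve:
  fixes L :: "'a::real_normed_vector \<Rightarrow> 'e::findim_inner \<Rightarrow> 'e"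
  assumes S: "open S" and L: "\<And>u. continuous_on S (\<lambda>x. L x u)" and lin: "\<And>x. x \<in> S \<Longrightarrow> linear (L x)"
    and inj: "\<And>x u. x \<in> S \<Longrightarrow> L x u = 0 \<Longrightarrow> u = 0"
    and eq: "\<And>x. x \<in> S \<Longrightarrow> L x (F x) = g x" and g: "continuous_on S g"
  shows "continuous_on S F"
proof (rule continuous_at_imp_continuous_on, rule ballI)
  fix x0 assume x0: "x0 \<in> S"
  obtain K where K: "bounded_linear K" "\<And>u. K (L x0 u) = u"
    using linear_inj_left_inverse_bounded[OF lin[OF x0] inj[OF x0]] by blast
  obtain C where C: "C > 0" "\<And>v. norm (K v) \<le> norm v * C" using bounded_linear.pos_bounded[OF K(1)] by blast
  define \<eta> where "\<eta> x = (\<Sum>b\<in>onb. norm (L x b - L x0 b))" for x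
  have evS: "\<forall>\<^sub>F x in at x0. x \<in> S" using S x0 by (rule eventually_at_in_open')
  have Lt: "((\<lambda>x. L x u) \<longlongrightarrow> L x0 u) (at x0)" for u
    using L[of u] S x0 by (simp add: continuous_on_eq_continuous_at isCont_def)
  have gt: "(g \<longlongrightarrow> g x0) (at x0)"
    using g S x0 by (simp add: continuous_on_eq_continuous_at isCont_def)
  have "(\<eta> \<longlongrightarrow> (\<Sum>b\<in>(onb::'e set). norm (L x0 b - L x0 b))) (at x0)"
    unfolding \<eta>_def by (intro tendsto_intros Lt)
  then have "(\<eta> \<longlongrightarrow> 0) (at x0)" by simp
  then have ev\<eta>: "\<forall>\<^sub>F x in at x0. \<eta> x < 1 / (2 * C)"
    by (rule order_tendstoD) (use C in simp)
  have "\<forall>\<^sub>F x in at x0. norm (F x - F x0) \<le> norm (g x - L x (F x0)) * (2 * C)"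
    using evS ev\<eta>
  proof eventually_elim
    case (elim x)
    define u where "u = F x - F x0"
    have lx: "linear (L x)" "linear (L x0)" using lin elim x0 by auto
    have ll: "linear (\<lambda>v. L x v - L x0 v)" using lx by (rule linear_compose_sub)
    have "norm u = norm (K (L x0 u))" by (simp add: K)
    also have "\<dots> \<le> norm (L x0 u) * C" by (rule C)
    also have "\<dots> \<le> (norm (L x u) + \<eta> x * norm u) * C"
      using norm_linear_onb_le[OF ll, of u] norm_triangle_sub[of "L x0 u" "L x u"] C(1)
      by (intro mult_right_mono) (auto simp: \<eta>_def norm_minus_commute)
    also have "\<dots> \<le> (norm (L x u) + 1 / (2 * C) * norm u) * C"
      using elim C(1) by (intro mult_right_mono add_left_mono) auto
    also have "\<dots> = norm (L x u) * C + norm u / 2" using C(1) by (simp add: field_simps)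
    finally have "norm u \<le> norm (L x u) * (2 * C)" by simp
    moreover have "L x u = g x - L x (F x0)"
      using eq elim linear_diff[OF lx(1)] by (simp add: u_def)
    ultimately show ?case by (simp add: u_def)
  qed
  moreover have "((\<lambda>x. norm (g x - L x (F x0)) * (2 * C)) \<longlongrightarrow> norm (g x0 - L x0 (F x0)) * (2 * C)) (at x0)"
    by (intro tendsto_intros gt Lt)
  then have "((\<lambda>x. norm (g x - L x (F x0)) * (2 * C)) \<longlongrightarrow> 0) (at x0)" by (simp add: eq x0)
  ultimately have "((\<lambda>x. F x - F x0) \<longlongrightarrow> 0) (at x0)" by (rule Lim_null_comparison)
  then show "isCont F x0" unfolding isCont_def by (rule LIM_zero_cancel)
qed

text \<open>With \<open>K\<close> inverting \<open>L x0\<close>, the equation reads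
  \<open>F x = K (g x - (L x - L x0) (F x))\<close>. The coefficient \<open>L x - L x0\<close>
  vanishes at \<open>x0\<close>, so continuity of \<open>F\<close> is enough to differentiate the
  right-hand side.\<close>

lemma differentiable_linear_solve:
  fixes L :: "'a::real_normed_vector \<Rightarrow> 'e::findim_inner \<Rightarrow> 'e"
  assumes S: "open S" and x0: "x0 \<in> S"
    and L: "\<And>u. (\<lambda>x. L x u) differentiable (at x0)" and lin: "\<And>x. x \<in> S \<Longrightarrow> linear (L x)"
    and inj: "\<And>u. L x0 u = 0 \<Longrightarrow> u = 0"
    and eq: "\<And>x. x \<in> S \<Longrightarrow> L x (F x) = g x" and g: "g differentiable (at x0)" and F: "isCont F x0"
  shows "F differentiable (at x0)"
proof -
  obtain K where K: "bounded_linear K" "\<And>u. K (L x0 u) = u"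
    using linear_inj_left_inverse_bounded[OF lin[OF x0] inj] by blast
  have "(\<lambda>x. (F x \<bullet> b) *\<^sub>R (L x b - L x0 b)) differentiable (at x0)" for b
  proof -
    obtain D where "((\<lambda>x. L x b) has_derivative D) (at x0)" using L[of b] unfolding differentiable_def by blast
    then have "((\<lambda>x. L x b - L x0 b) has_derivative (\<lambda>v. D v - 0)) (at x0)"
      by (intro has_derivative_diff) auto
    from has_derivative_scaleR_vanishing[OF _ this, of "\<lambda>x. F x \<bullet> b"] F
    show ?thesis unfolding differentiable_def by (auto intro: continuous_intros)
  qed
  then have "(\<lambda>x. \<Sum>b\<in>onb. (F x \<bullet> b) *\<^sub>R (L x b - L x0 b)) differentiable (at x0)"
    by (intro differentiable_sum) auto
  then have "(\<lambda>x. g x - (\<Sum>b\<in>onb. (F x \<bullet> b) *\<^sub>R (L x b - L x0 b))) differentiable (at x0)"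
    by (intro differentiable_diff g)
  then obtain D where "((\<lambda>x. g x - (\<Sum>b\<in>onb. (F x \<bullet> b) *\<^sub>R (L x b - L x0 b))) has_derivative D) (at x0)"
    unfolding differentiable_def by blast
  then have d: "((\<lambda>x. K (g x - (\<Sum>b\<in>onb. (F x \<bullet> b) *\<^sub>R (L x b - L x0 b)))) has_derivative (\<lambda>v. K (D v))) (at x0)"
    by (rule bounded_linear.has_derivative[OF K(1)])
  have "K (g x - (\<Sum>b\<in>onb. (F x \<bullet> b) *\<^sub>R (L x b - L x0 b))) = F x" if "x \<in> S" for x
  proof -
    have "(\<Sum>b\<in>onb. (F x \<bullet> b) *\<^sub>R (L x b - L x0 b)) = L x (F x) - L x0 (F x)"
      using linear_onb[OF lin[OF that], of "F x"] linear_onb[OF lin[OF x0], of "F x"]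
      by (simp add: scaleR_diff_right sum_subtractf)
    then show ?thesis using eq[OF that] K(2)[of "F x"] by simp
  qed
  then have "(F has_derivative (\<lambda>v. K (D v))) (at x0)"
    using has_derivative_transform_within_open[OF d S x0] by blast
  then show ?thesis unfolding differentiable_def by blast
qed

text \<open>Differentiating \<open>L x (F x) = g x\<close> shows that a directional derivative of
  \<open>F\<close> solves a system with the same coefficients \<open>L\<close> and a right-hand side
  built from \<open>g'\<close>, \<open>L'\<close> and \<open>F\<close>. The induction over
  \<open>k\<close> therefore varies \<open>F\<close> and \<open>g\<close> and never differentiates
  an inverse map.\<close>

lemma Ck_on_linear_solve:
  fixes L :: "'a::real_normed_vector \<Rightarrow> 'e::findim_inner \<Rightarrow> 'e"
  assumes S: "open S" and L: "\<And>u. Cinf_on S (\<lambda>x. L x u)" and lin: "\<And>x. x \<in> S \<Longrightarrow> linear (L x)"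
    and inj: "\<And>x u. x \<in> S \<Longrightarrow> L x u = 0 \<Longrightarrow> u = 0"
    and eq: "\<And>x. x \<in> S \<Longrightarrow> L x (F x) = g x" and g: "Ck_on k S g"
  shows "Ck_on k S F"
  using eq g
proof (induction k arbitrary: F g)
  case 0
  then show ?case
    using continuous_on_linear_solve[OF S Cinf_on_continuous_on[OF L] lin inj] by auto
next
  case (Suc k)
  have IH: "Ck_on k S F" by (rule Suc.IH[OF Suc.prems(1) Ck_on_SucD[OF Suc.prems(2)]])
  have dF: "F differentiable (at x)" if x: "x \<in> S" for x
  proof (rule differentiable_linear_solve[OF S x _ lin inj[OF x] Suc.prems(1)])
    show "(\<lambda>x. L x u) differentiable (at x)" for u
      using Cinf_on_has_derivative[OF L x] unfolding differentiable_def by blast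
    show "g differentiable (at x)" using Suc.prems(2) x by simp
    show "isCont F x" using Ck_on_continuous_on[OF IH] S x by (simp add: continuous_on_eq_continuous_at)
  qed
  let ?L' = "\<lambda>b x v. frechet_derivative (\<lambda>x. L x b) (at x) v"
  let ?F' = "\<lambda>x v. frechet_derivative F (at x) v"
  let ?g' = "\<lambda>x v. frechet_derivative g (at x) v"
  have *: "L x (?F' x v) = ?g' x v - (\<Sum>b\<in>onb. (F x \<bullet> b) *\<^sub>R ?L' b x v)" if x: "x \<in> S" for x v
  proof -
    have F: "(F has_derivative ?F' x) (at x)" using dF[OF x] by (simp add: frechet_derivative_works[symmetric])
    have "((\<lambda>x. \<Sum>b\<in>onb. (F x \<bullet> b) *\<^sub>R L x b) has_derivative
       (\<lambda>v. \<Sum>b\<in>onb. (F x \<bullet> b) *\<^sub>R ?L' b x v + (?F' x v \<bullet> b) *\<^sub>R L x b)) (at x)"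
      by (intro has_derivative_sum has_derivative_scaleR Cinf_on_has_derivative[OF L x] has_derivative_inner_left F)
    moreover have "(\<Sum>b\<in>onb. (F y \<bullet> b) *\<^sub>R L y b) = g y" if "y \<in> S" for y
      using linear_onb[OF lin[OF that], of "F y"] Suc.prems(1)[OF that] by simp
    ultimately have g': "(g has_derivative
       (\<lambda>v. \<Sum>b\<in>onb. (F x \<bullet> b) *\<^sub>R ?L' b x v + (?F' x v \<bullet> b) *\<^sub>R L x b)) (at x)"
      using has_derivative_transform_within_open[OF _ S x] by blast
    have "?g' x v = (\<Sum>b\<in>onb. (F x \<bullet> b) *\<^sub>R ?L' b x v + (?F' x v \<bullet> b) *\<^sub>R L x b)"
      using fun_cong[OF frechet_derivative_at[OF g'], of v] by simp
    then show ?thesis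
      using linear_onb[OF lin[OF x], of "?F' x v"] by (simp add: sum.distrib)
  qed
  have "Ck_on k S (\<lambda>x. ?F' x v)" for v
  proof (rule Suc.IH[OF *])
    have "Ck_on k S (\<lambda>x. ?g' x v + (\<Sum>b\<in>onb. (-1) *\<^sub>R ((F x \<bullet> b) *\<^sub>R ?L' b x v)))"
    proof (intro Ck_on_add Ck_on_sum Ck_on_scaleR S Ck_on_const)
      show "Ck_on k S (\<lambda>x. ?g' x v)" using Suc.prems by simp
      show "Ck_on k S (\<lambda>x. F x \<bullet> b)" for b
        by (rule Ck_on_bounded_linear[OF bounded_linear_inner_left S IH])
      show "Ck_on k S (\<lambda>x. ?L' b x v)" for b
        using Cinf_on_derivative[OF L] unfolding Cinf_on_def by blast
    qed
    then show "Ck_on k S (\<lambda>x. ?g' x v - (\<Sum>b\<in>onb. (F x \<bullet> b) *\<^sub>R ?L' b x v))"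
      by (simp add: sum_negf)
  qed
  then show ?case using dF by simp
qed

section \<open>A flat function\<close>

text \<open>The derivative of \<open>flat n\<close> is a linear combination of \<open>flat (n + 1)\<close> and \<open>flat (n + 2)\<close>, so all the
  functions of the family are smooth, and flat at \<open>0\<close>.\<close>

definition flat :: "nat \<Rightarrow> real \<Rightarrow> real" where
  "flat n x = (if x > 0 then inverse x ^ n * exp (- inverse x) else 0)"

lemma flat_tendsto: "(flat n \<longlongrightarrow> 0) (at 0)"
proof -
  have "((\<lambda>x. x ^ n / exp x) \<longlongrightarrow> (0::real)) at_top" by (rule tendsto_power_div_exp_0)
  then have "((\<lambda>x. inverse x ^ n / exp (inverse x)) \<longlongrightarrow> (0::real)) (at_right 0)"
    by (rule filterlim_compose[OF _ filterlim_inverse_at_top_right])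
  then have "(flat n \<longlongrightarrow> 0) (at_right 0)"
    by (rule Lim_transform_eventually)
      (auto simp: flat_def eventually_at_filter exp_minus divide_inverse)
  moreover have "(flat n \<longlongrightarrow> 0) (at_left 0)"
    by (rule Lim_transform_eventually[OF tendsto_const]) (auto simp: flat_def eventually_at_filter)
  ultimately show ?thesis by (simp add: filterlim_split_at)
qed

lemma flat_deriv: "(flat n has_real_derivative flat (n + 2) x - n * flat (n + 1) x) (at x)"
proof -
  consider "x > 0" | "x < 0" | "x = 0" by linarith
  then show ?thesis
  proof cases
    case 1
    have "((\<lambda>x. inverse x ^ n * exp (- inverse x)) has_real_derivative flat (n + 2) x - n * flat (n + 1) x) (at x)"
      using 1 by (auto intro!: derivative_eq_intros simp: flat_def power2_eq_square)
        (cases n; simp add: algebra_simps)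
    then show ?thesis
      by (rule has_field_derivative_transform_within[where d=x]) (use 1 in \<open>auto simp: flat_def dist_real_def\<close>)
  next
    case 2
    have "((\<lambda>x. 0) has_real_derivative flat (n + 2) x - n * flat (n + 1) x) (at x)"
      using 2 by (auto simp: flat_def)
    then show ?thesis
      by (rule has_field_derivative_transform_within[where d="-x"]) (use 2 in \<open>auto simp: flat_def dist_real_def\<close>)
  next
    case 3
    \<comment> \<open>Dividing by \<open>h\<close> contributes one more factor
      \<open>inverse h\<close>, so this difference quotient is \<open>flat (Suc n)\<close>
      itself.\<close>
    have "((\<lambda>h. (flat n (0 + h) - flat n 0) / h) \<longlongrightarrow> 0) (at 0)"
      by (rule Lim_transform_eventually[OF flat_tendsto[of "Suc n"]])
        (auto simp: flat_def eventually_at_filter divide_inverse)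
    then show ?thesis using 3 by (simp add: DERIV_def flat_def)
  qed
qed

lemma Ck_on_flat: "Ck_on k UNIV (flat n)"
proof (induction k arbitrary: n)
  case 0
  show ?case by (auto intro!: continuous_at_imp_continuous_on DERIV_isCont[OF flat_deriv])
next
  case (Suc k)
  show ?case
  proof (rule Ck_on_SucI[OF open_UNIV])
    show "(flat n has_derivative (\<lambda>v. v *\<^sub>R flat (n + 2) x + (- (v * n)) *\<^sub>R flat (n + 1) x)) (at x)" for x
      using flat_deriv[of n x] unfolding has_field_derivative_def
      by (rule has_derivative_eq_rhs) (auto simp: algebra_simps)
    show "Ck_on k UNIV (\<lambda>x. v *\<^sub>R flat (n + 2) x + (- (v * n)) *\<^sub>R flat (n + 1) x)" for v
      by (intro Ck_on_add Ck_on_scaleR Ck_on_const Suc open_UNIV)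
  qed
qed

lemma Cinf_on_flat: "Cinf_on UNIV (flat n)"
  unfolding Cinf_on_def by (simp add: Ck_on_flat)

section \<open>Ordinary differential equations\<close>

lemma has_vector_derivative_bound:
  fixes f :: "real \<Rightarrow> 'e::real_normed_vector"
  assumes "convex S" "\<And>t. t \<in> S \<Longrightarrow> (f has_vector_derivative f' t) (at t within S)"
    "\<And>t. t \<in> S \<Longrightarrow> norm (f' t) \<le> B" "s \<in> S" "t \<in> S"
  shows "norm (f t - f s) \<le> B * \<bar>t - s\<bar>"
proof -
  have "norm (f t - f s) \<le> B * norm (t - s)"
  proof (rule differentiable_bound[OF assms(1)])
    fix u assume u: "u \<in> S"
    show "(f has_derivative (\<lambda>h. h *\<^sub>R f' u)) (at u within S)"
      using assms(2)[OF u] by (simp add: has_vector_derivative_def)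
    show "onorm (\<lambda>h. h *\<^sub>R f' u) \<le> B"
      by (rule onorm_le) (use assms(3)[OF u] in \<open>auto simp: mult.commute[of B] mult_left_mono\<close>)
  qed (use assms in auto)
  then show ?thesis by simp
qed

text \<open>On a short interval no Gronwall estimate is required: if \<open>D\<close> is the maximal
  distance of the two curves, the Lipschitz bound and the mean value inequality from the common
  point \<open>s\<close> give \<open>D \<le> D / 2\<close>. The Lipschitz bound is assumed only
  along the two curves.\<close>

lemma ode_unique_short:
  fixes F :: "real \<Rightarrow> 'e::real_normed_vector \<Rightarrow> 'e"
  assumes s: "s \<in> {a..b}" and L: "(b - a) * L \<le> 1/2" "L \<ge> 0"
    and lip: "\<And>t. t \<in> {a..b} \<Longrightarrow> norm (F t (x t) - F t (z t)) \<le> L * norm (x t - z t)"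
    and x: "\<And>t. t \<in> {a..b} \<Longrightarrow> (x has_vector_derivative F t (x t)) (at t within {a..b})"
    and z: "\<And>t. t \<in> {a..b} \<Longrightarrow> (z has_vector_derivative F t (z t)) (at t within {a..b})"
    and eq: "x s = z s" and t: "t \<in> {a..b}"
  shows "x t = z t"
proof -
  have d: "((\<lambda>t. x t - z t) has_vector_derivative F t (x t) - F t (z t)) (at t within {a..b})"
    if "t \<in> {a..b}" for t
    using x[OF that] z[OF that] by (rule has_vector_derivative_diff)
  have "continuous_on {a..b} (\<lambda>t. norm (x t - z t))"
    by (intro continuous_on_norm continuous_on_vector_derivative[OF d])
  then obtain m where m: "m \<in> {a..b}" "\<And>t. t \<in> {a..b} \<Longrightarrow> norm (x t - z t) \<le> norm (x m - z m)"
    using continuous_attains_sup[of "{a..b}" "\<lambda>t. norm (x t - z t)"] s by auto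
  define D where "D = norm (x m - z m)"
  have "norm ((x m - z m) - (x s - z s)) \<le> (L * D) * \<bar>m - s\<bar>"
  proof (rule has_vector_derivative_bound[OF _ d])
    fix t assume t: "t \<in> {a..b}"
    show "norm (F t (x t) - F t (z t)) \<le> L * D"
      using lip[OF t] m(2)[OF t] L(2) unfolding D_def by (meson mult_left_mono order_trans)
  qed (use s m in auto)
  also have "\<dots> \<le> (L * D) * (b - a)"
    using s m(1) L(2) by (intro mult_left_mono) (auto simp: D_def)
  also have "\<dots> = D * ((b - a) * L)" by simp
  also have "\<dots> \<le> D * (1/2)" using L by (intro mult_left_mono) (auto simp: D_def)
  finally have "D \<le> D / 2" using eq by (simp add: D_def)
  then have "D \<le> 0" by simp
  then show ?thesis using m(2)[OF t] by (simp add: D_def)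
qed

text \<open>Picard iteration as a Banach fixed point: \<open>e * M \<le> r\<close> keeps the
  iterates in the ball, and \<open>e * L \<le> 1/2\<close> makes the iteration a contraction. The
  initial time is the midpoint, so the solution runs in both directions.\<close>

lemma ode_exists_short:
  fixes F :: "real \<Rightarrow> 'e::banach \<Rightarrow> 'e"
  assumes e: "e > 0" and eM: "e * M \<le> r" and eL: "e * L \<le> 1/2" and r: "r \<ge> 0"
    and cont: "continuous_on ({s-e..s+e} \<times> cball y r) (\<lambda>(t, y). F t y)"
    and M: "\<And>t u. t \<in> {s-e..s+e} \<Longrightarrow> u \<in> cball y r \<Longrightarrow> norm (F t u) \<le> M"
    and L: "\<And>t u v. t \<in> {s-e..s+e} \<Longrightarrow> u \<in> cball y r \<Longrightarrow> v \<in> cball y r \<Longrightarrow> norm (F t u - F t v) \<le> L * norm (u - v)"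
    and L0: "L \<ge> 0"
  shows "\<exists>z. z s = y \<and> (\<forall>t\<in>{s-e..s+e}. z t \<in> cball y r \<and>
     (z has_vector_derivative F t (z t)) (at t within {s-e..s+e}))"
proof -
  define I where "I = {s-e..s+e}"
  have sI: "s \<in> I" using e by (simp add: I_def)
  \<comment> \<open>The complete space used consists of bounded continuous functions on all of
    \<open>real\<close>; clamping the time extends an iterate from \<open>I\<close> to the whole
    line.\<close>
  define cl where "cl t = max (s-e) (min (s+e) t)" for t
  have cl: "cl t \<in> I" "t \<in> I \<Longrightarrow> cl t = t" for t using e by (auto simp: cl_def I_def)
  have ccl: "continuous_on UNIV cl" unfolding cl_def by (intro continuous_intros)
  \<comment> \<open>Integration starts at the left end of \<open>I\<close>; the difference
    \<open>J z t - J z s\<close> is then the oriented integral from \<open>s\<close> to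
    \<open>t\<close> on either side of \<open>s\<close>.\<close>
  define J where "J z t = integral {s-e..t} (\<lambda>\<tau>. F \<tau> (z \<tau>))" for z t
  define P where "P = {z :: real \<Rightarrow>\<^sub>C 'e. \<forall>t. apply_bcontfun z t \<in> cball y r}"
  define T where "T z t = y + (J (apply_bcontfun z) (cl t) - J (apply_bcontfun z) s)" for z :: "real \<Rightarrow>\<^sub>C 'e" and t
  have Jd: "(J (apply_bcontfun z) has_vector_derivative F t (apply_bcontfun z t)) (at t within I)"
    if z: "z \<in> P" and t: "t \<in> I" for z t
  proof -
    have "continuous_on I (\<lambda>\<tau>. (\<lambda>(t, y). F t y) (\<tau>, apply_bcontfun z \<tau>))"
      by (rule continuous_on_compose2[OF cont])
        (use z in \<open>auto intro!: continuous_intros simp: P_def I_def\<close>)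
    then show ?thesis using t unfolding I_def J_def
      by (auto intro!: integral_has_vector_derivative)
  qed
  have convI: "convex I" by (simp add: I_def)
  have abs: "\<bar>cl t - s\<bar> \<le> e" for t using cl(1)[of t] by (auto simp: I_def)
  have Tr: "T z t \<in> cball y r" if z: "z \<in> P" for z t
  proof -
    have "norm (J (apply_bcontfun z) (cl t) - J (apply_bcontfun z) s) \<le> M * \<bar>cl t - s\<bar>"
      by (rule has_vector_derivative_bound[OF convI Jd[OF z]]) (use z M cl sI in \<open>auto simp: P_def I_def\<close>)
    also have "\<dots> \<le> M * e"
    proof (rule mult_left_mono[OF abs])
      have "norm (F s y) \<le> M" using M[of s y] sI r by (simp add: I_def)
      then show "0 \<le> M" by (meson norm_ge_zero order_trans)
    qed
    finally show ?thesis using eM by (simp add: T_def dist_norm mult.commute norm_minus_commute)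
  qed
  have Tbc: "T z \<in> bcontfun" if z: "z \<in> P" for z
  proof (rule bcontfun_normI)
    have "continuous_on I (J (apply_bcontfun z))"
      by (rule continuous_on_vector_derivative[OF Jd[OF z]])
    then have "continuous_on UNIV (\<lambda>t. J (apply_bcontfun z) (cl t))"
      by (rule continuous_on_compose2[OF _ ccl]) (use cl in auto)
    then show "continuous_on UNIV (T z)" unfolding T_def by (intro continuous_intros)
    show "norm (T z t) \<le> norm y + r" for t
      using Tr[OF z, of t] norm_triangle_sub[of "T z t" y] by (simp add: dist_norm norm_minus_commute)
  qed
  have app: "apply_bcontfun (Bcontfun (T z)) = T z" if "z \<in> P" for z
    using Bcontfun_inverse Tbc[OF that] by blast
  have "\<exists>!z\<in>P. Bcontfun (T z) = z"
  proof (rule Banach_fix[where c="1/2"])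
    have "closed P"
    proof -
      have "P = (\<Inter>t. (\<lambda>z. apply_bcontfun z t) -` cball y r)" by (auto simp: P_def)
      moreover have "closed ((\<lambda>z::real \<Rightarrow>\<^sub>C 'e. apply_bcontfun z t) -` cball y r)" for t
      proof (rule closed_vimage)
        show "continuous_on UNIV (\<lambda>z::real \<Rightarrow>\<^sub>C 'e. apply_bcontfun z t)"
          unfolding continuous_on_iff by (meson dist_bounded le_less_trans)
      qed simp
      ultimately show ?thesis by auto
    qed
    then show "complete P" by (simp add: complete_eq_closed)
    have "const_bcontfun y \<in> P" using r by (simp add: P_def const_bcontfun.rep_eq)
    then show "P \<noteq> {}" by blast
    show "(\<lambda>z. Bcontfun (T z)) ` P \<subseteq> P"
      using app Tr by (auto simp: P_def)
    show "dist (Bcontfun (T z)) (Bcontfun (T w)) \<le> 1/2 * dist z w" if zw: "z \<in> P" "w \<in> P" for z w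
    proof (rule dist_bound)
      fix t
      let ?J = "\<lambda>t. J (apply_bcontfun z) t - J (apply_bcontfun w) t"
      have "norm (?J (cl t) - ?J s) \<le> (L * dist z w) * \<bar>cl t - s\<bar>"
      proof (rule has_vector_derivative_bound[OF convI has_vector_derivative_diff[OF Jd[OF zw(1)] Jd[OF zw(2)]]])
        fix \<tau> assume "\<tau> \<in> I"
        then have "norm (F \<tau> (apply_bcontfun z \<tau>) - F \<tau> (apply_bcontfun w \<tau>)) \<le> L * norm (apply_bcontfun z \<tau> - apply_bcontfun w \<tau>)"
          using zw L by (auto simp: P_def I_def)
        also have "\<dots> \<le> L * dist z w"
          using dist_bounded[of z \<tau> w] L0 by (intro mult_left_mono) (auto simp: dist_norm)
        finally show "norm (F \<tau> (apply_bcontfun z \<tau>) - F \<tau> (apply_bcontfun w \<tau>)) \<le> L * dist z w" .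
      qed (use sI cl in auto)
      also have "\<dots> \<le> (L * dist z w) * e" using abs L0 by (intro mult_left_mono) auto
      also have "\<dots> \<le> 1/2 * dist z w" using mult_right_mono[OF eL, of "dist z w"] by (simp add: mult_ac)
      finally have "norm (?J (cl t) - ?J s) \<le> 1/2 * dist z w" .
      moreover have "T z t - T w t = ?J (cl t) - ?J s" by (simp add: T_def)
      ultimately show "dist (apply_bcontfun (Bcontfun (T z)) t) (apply_bcontfun (Bcontfun (T w)) t) \<le> 1/2 * dist z w"
        by (simp add: app zw dist_norm)
    qed
  qed auto
  then obtain z where z: "z \<in> P" "Bcontfun (T z) = z" by blast
  then have zT: "apply_bcontfun z = T z" using app by metis
  have "(T z has_vector_derivative F t (apply_bcontfun z t)) (at t within I)" if t: "t \<in> I" for t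
  proof -
    have "((\<lambda>t. y + (J (apply_bcontfun z) t - J (apply_bcontfun z) s)) has_vector_derivative 0 + (F t (apply_bcontfun z t) - 0)) (at t within I)"
      by (intro has_vector_derivative_add has_vector_derivative_diff has_vector_derivative_const Jd z t)
    then have "((\<lambda>t. y + (J (apply_bcontfun z) t - J (apply_bcontfun z) s)) has_vector_derivative F t (apply_bcontfun z t)) (at t within I)"
      by simp
    then show ?thesis
      by (rule has_vector_derivative_transform[OF t, rotated]) (simp add: T_def cl)
  qed
  moreover have "T z s = y" using cl sI by (simp add: T_def)
  ultimately show ?thesis
    using Tr[OF z(1)] zT unfolding I_def by (intro exI[of _ "T z"]) auto
qed

text \<open>Compactness of a small cylinder bounds \<open>F\<close> and its spatial derivatives.
  Summing the bounds in the directions \<open>(0, b)\<close> over \<open>onb\<close> gives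
  \<open>L\<close>, and convexity of the ball turns this into a Lipschitz estimate.\<close>

lemma Cinf_on_cylinder_bounds:
  fixes F :: "real \<times> 'e::findim_inner \<Rightarrow> 'w::real_normed_vector"
  assumes W: "open W" and F: "Cinf_on W F" and p: "(t0, y0) \<in> W"
  obtains r M L where "r > 0" "M \<ge> 0" "L \<ge> 0" "{t0-r..t0+r} \<times> cball y0 r \<subseteq> W"
    "\<And>t u. t \<in> {t0-r..t0+r} \<Longrightarrow> u \<in> cball y0 r \<Longrightarrow> norm (F (t, u)) \<le> M"
    "\<And>t u v. t \<in> {t0-r..t0+r} \<Longrightarrow> u \<in> cball y0 r \<Longrightarrow> v \<in> cball y0 r \<Longrightarrow>
       norm (F (t, u) - F (t, v)) \<le> L * norm (u - v)"
proof -
  obtain A B where AB: "open A" "open B" "(t0, y0) \<in> A \<times> B" "A \<times> B \<subseteq> W"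
    using open_prod_elim[OF W p] by metis
  obtain r1 where r1: "r1 > 0" "cball t0 r1 \<subseteq> A" using AB by (meson SigmaD1 open_contains_cball)
  obtain r2 where r2: "r2 > 0" "cball y0 r2 \<subseteq> B" using AB by (meson SigmaD2 open_contains_cball)
  define r where "r = min r1 r2"
  have r: "r > 0" using r1 r2 by (simp add: r_def)
  define K where "K = {t0-r..t0+r} \<times> cball y0 r"
  have "{t0-r..t0+r} \<subseteq> A" "cball y0 r \<subseteq> B"
    using subset_trans[OF subset_cball r1(2), of r] subset_trans[OF subset_cball r2(2), of r]
    by (simp_all add: r_def cball_eq_atLeastAtMost)
  then have KW: "K \<subseteq> W" using AB(4) by (auto simp: K_def)
  have cK: "compact K" unfolding K_def by (intro compact_Times) auto
  have bdd: "\<exists>C\<ge>0. \<forall>p\<in>K. norm (f p) \<le> C" if "Cinf_on W f" for f :: "real \<times> 'e \<Rightarrow> 'w"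
  proof -
    have "continuous_on K f" using Cinf_on_continuous_on[OF that] KW continuous_on_subset by blast
    then have "bounded (f ` K)" using cK compact_continuous_image compact_imp_bounded by blast
    then obtain C where "C > 0" "\<forall>y\<in>f ` K. norm y \<le> C" by (meson bounded_pos)
    then show ?thesis by (intro exI[of _ C]) auto
  qed
  obtain M where M: "M \<ge> 0" "\<And>p. p \<in> K \<Longrightarrow> norm (F p) \<le> M" using bdd[OF F] by blast
  have "\<forall>b. \<exists>C\<ge>0. \<forall>p\<in>K. norm (frechet_derivative F (at p) (0, b)) \<le> C"
    using bdd[OF Cinf_on_derivative[OF F]] by blast
  then obtain C where C: "\<And>b. C b \<ge> 0" "\<And>b p. p \<in> K \<Longrightarrow> norm (frechet_derivative F (at p) (0, b)) \<le> C b"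
    by metis
  define L where "L = sum C (onb :: 'e set)"
  have lip: "norm (F (t, u) - F (t, v)) \<le> L * norm (u - v)"
    if t: "t \<in> {t0-r..t0+r}" and u: "u \<in> cball y0 r" and v: "v \<in> cball y0 r" for t u v
  proof (rule differentiable_bound[of "cball y0 r" "\<lambda>y. F (t, y)"])
    fix y assume y: "y \<in> cball y0 r"
    then have pK: "(t, y) \<in> K" using t by (simp add: K_def)
    have FD: "(F has_derivative frechet_derivative F (at (t, y))) (at (t, y))"
      using Cinf_on_has_derivative[OF F] pK KW by blast
    have "((\<lambda>y. (t, y)) has_derivative (\<lambda>h. (0, h))) (at y within cball y0 r)"
      by (auto intro!: derivative_eq_intros)
    from has_derivative_compose[OF this FD]
    show "((\<lambda>y. F (t, y)) has_derivative (\<lambda>h. frechet_derivative F (at (t, y)) (0, h))) (at y within cball y0 r)" .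
    have "linear (frechet_derivative F (at (t, y)))" using FD by (rule has_derivative_linear)
    then have "linear (\<lambda>h. frechet_derivative F (at (t, y)) (0, h))"
      using linear_compose[of "\<lambda>h. (0::real, h)" "frechet_derivative F (at (t, y))"] by (simp add: o_def linear_iff)
    note bnd = norm_linear_onb_le[OF this]
    have "(\<Sum>b\<in>(onb :: 'e set). norm (frechet_derivative F (at (t, y)) (0, b))) \<le> L"
      unfolding L_def by (intro sum_mono C pK)
    then have bnd': "norm (frechet_derivative F (at (t, y)) (0, h)) \<le> L * norm h" for h
      using bnd[of h] by (meson mult_right_mono norm_ge_zero order_trans)
    show "onorm (\<lambda>h. frechet_derivative F (at (t, y)) (0, h)) \<le> L"
      by (rule onorm_bound[OF _ bnd']) (auto intro: C sum_nonneg simp: L_def)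
  qed (use u v in auto)
  show ?thesis
    by (rule that[OF r M(1) _ KW[unfolded K_def] _ lip]) (auto intro: M C sum_nonneg simp: K_def L_def)
qed

text \<open>The point is that \<open>e\<close> serves all initial data near \<open>(t0, y0)\<close>,
  as the later compactness argument demands. Half of the cylinder is reserved for moving the initial
  data, the other half for the motion of the solution.\<close>

lemma ode_exists_local:
  fixes F :: "real \<times> 'e::findim_inner \<Rightarrow> 'e"
  assumes W: "open W" and F: "Cinf_on W F" and p: "(t0, y0) \<in> W"
  obtains e d where "e > 0" "d > 0"
    "\<And>s y. \<bar>s - t0\<bar> < d \<Longrightarrow> dist y0 y < d \<Longrightarrow> \<exists>z. z s = y \<and> (\<forall>t\<in>{s-e..s+e}. (t, z t) \<in> W \<and>
      (z has_vector_derivative F (t, z t)) (at t within {s-e..s+e}))"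
proof -
  obtain r M L where r: "r > 0" "M \<ge> 0" "L \<ge> 0" and sub: "{t0-r..t0+r} \<times> cball y0 r \<subseteq> W"
    and M: "\<And>t u. t \<in> {t0-r..t0+r} \<Longrightarrow> u \<in> cball y0 r \<Longrightarrow> norm (F (t, u)) \<le> M"
    and L: "\<And>t u v. t \<in> {t0-r..t0+r} \<Longrightarrow> u \<in> cball y0 r \<Longrightarrow> v \<in> cball y0 r \<Longrightarrow>
       norm (F (t, u) - F (t, v)) \<le> L * norm (u - v)"
    using Cinf_on_cylinder_bounds[OF W F p] by blast
  \<comment> \<open>The three bounds keep the time interval in the cylinder, the solution within
    distance \<open>r/2\<close> of its start, and the contraction factor at most 1/2. The summands 1
    avoid division by zero.\<close>
  define e where "e = min (r/2) (min (r / (2 * (M + 1))) (1 / (2 * (L + 1))))"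
  have "e > 0" using r by (simp add: e_def)
  moreover have "e \<le> r/2" unfolding e_def by (rule min.cobounded1)
  ultimately have e: "e > 0" "e \<le> r/2" .
  have eM: "e * M \<le> r/2"
  proof -
    have "e * M \<le> e * (M + 1)" using e by simp
    also have "\<dots> \<le> r / (2 * (M + 1)) * (M + 1)" using r by (intro mult_right_mono) (auto simp: e_def)
    also have "\<dots> = r/2" using r by (simp add: field_simps)
    finally show ?thesis .
  qed
  have eL: "e * L \<le> 1/2"
  proof -
    have "e * L \<le> e * (L + 1)" using e by simp
    also have "\<dots> \<le> 1 / (2 * (L + 1)) * (L + 1)" using r by (intro mult_right_mono) (auto simp: e_def)
    also have "\<dots> = 1/2" using r by (simp add: field_simps)
    finally show ?thesis .
  qed
  show ?thesis
  proof (rule that[of e "r/2"])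
    fix s y assume s: "\<bar>s - t0\<bar> < r/2" and y: "dist y0 y < r/2"
    have "t0 - r \<le> s - e" "s + e \<le> t0 + r" using s e by linarith+
    then have I: "{s-e..s+e} \<subseteq> {t0-r..t0+r}" by auto
    have B: "u \<in> cball y0 r" if "u \<in> cball y (r/2)" for u
      using that y dist_triangle[of y0 u y] by simp
    have "\<exists>z. z s = y \<and> (\<forall>t\<in>{s-e..s+e}. z t \<in> cball y (r/2) \<and>
       (z has_vector_derivative F (t, z t)) (at t within {s-e..s+e}))"
    proof (rule ode_exists_short[OF e(1) eM eL])
      show "continuous_on ({s-e..s+e} \<times> cball y (r/2)) (\<lambda>(t, y). F (t, y))"
        using continuous_on_subset[OF Cinf_on_continuous_on[OF F], of "{s-e..s+e} \<times> cball y (r/2)"] sub I B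
        by (auto simp: split_beta' subset_iff)
    qed (use r M L I B in \<open>auto simp: subset_iff simp del: mem_cball\<close>)
    then obtain z where z: "z s = y" "\<And>t. t \<in> {s-e..s+e} \<Longrightarrow> z t \<in> cball y (r/2)"
       "\<And>t. t \<in> {s-e..s+e} \<Longrightarrow> (z has_vector_derivative F (t, z t)) (at t within {s-e..s+e})" by blast
    have "(t, z t) \<in> W" if "t \<in> {s-e..s+e}" for t
      using I B[OF z(2)[OF that]] sub that by blast
    with z show "\<exists>z. z s = y \<and> (\<forall>t\<in>{s-e..s+e}. (t, z t) \<in> W \<and>
      (z has_vector_derivative F (t, z t)) (at t within {s-e..s+e}))" by blast
  qed (use r e in auto)
qed

text \<open>Supplies the openness half of a connectedness argument: the equations are assumed only
  near \<open>t0\<close>, and continuity keeps both curves in a cylinder with a Lipschitz bound for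
  a short time.\<close>

lemma ode_unique_local:
  fixes F :: "real \<times> 'e::findim_inner \<Rightarrow> 'e"
  assumes W: "open W" and F: "Cinf_on W F" and p: "(t0, x t0) \<in> W" and \<eta>: "\<eta> > 0" and t0: "t0 \<in> {a..b}"
    and x: "\<And>t. t \<in> {a..b} \<Longrightarrow> \<bar>t - t0\<bar> < \<eta> \<Longrightarrow> (x has_vector_derivative F (t, x t)) (at t within {a..b})"
    and z: "\<And>t. t \<in> {a..b} \<Longrightarrow> \<bar>t - t0\<bar> < \<eta> \<Longrightarrow> (z has_vector_derivative F (t, z t)) (at t within {a..b})"
    and eq: "x t0 = z t0"
  obtains \<epsilon> where "\<epsilon> > 0" "\<And>t. t \<in> {a..b} \<Longrightarrow> \<bar>t - t0\<bar> < \<epsilon> \<Longrightarrow> x t = z t"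
proof -
  obtain r M L where r: "r > 0" "M \<ge> 0" "L \<ge> 0" and "{t0-r..t0+r} \<times> cball (x t0) r \<subseteq> W"
    and "\<And>t u. t \<in> {t0-r..t0+r} \<Longrightarrow> u \<in> cball (x t0) r \<Longrightarrow> norm (F (t, u)) \<le> M"
    and L: "\<And>t u v. t \<in> {t0-r..t0+r} \<Longrightarrow> u \<in> cball (x t0) r \<Longrightarrow> v \<in> cball (x t0) r \<Longrightarrow>
       norm (F (t, u) - F (t, v)) \<le> L * norm (u - v)"
    using Cinf_on_cylinder_bounds[OF W F p] by blast
  have cx: "continuous (at t0 within {a..b}) x" and cz: "continuous (at t0 within {a..b}) z"
    using x[OF t0] z[OF t0] \<eta> by (auto intro: has_vector_derivative_continuous)
  obtain d1 where d1: "d1 > 0" "\<And>t. t \<in> {a..b} \<Longrightarrow> \<bar>t - t0\<bar> < d1 \<Longrightarrow> dist (x t) (x t0) < r"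
    using cx r(1) unfolding continuous_within_eps_delta dist_real_def by metis
  obtain d2 where d2: "d2 > 0" "\<And>t. t \<in> {a..b} \<Longrightarrow> \<bar>t - t0\<bar> < d2 \<Longrightarrow> dist (z t) (z t0) < r"
    using cz r(1) unfolding continuous_within_eps_delta dist_real_def by metis
  \<comment> \<open>The interval used has length at most \<open>2 * \<epsilon>\<close>, hence the
    factor 4 in the last bound; the halves give the strict inequalities.\<close>
  define \<epsilon> where "\<epsilon> = min (min (\<eta>/2) (r/2)) (min (min (d1/2) (d2/2)) (1 / (4 * (L + 1))))"
  have \<epsilon>: "\<epsilon> > 0" "\<epsilon> < \<eta>" "\<epsilon> < r" "\<epsilon> < d1" "\<epsilon> < d2" "\<epsilon> \<le> 1 / (4 * (L + 1))"
    using r \<eta> d1(1) d2(1) by (auto simp: \<epsilon>_def min_def)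
  \<comment> \<open>\<open>t0\<close> may be an end point of \<open>{a..b}\<close>, so the short
    interval around it is cut off there.\<close>
  define a' b' where "a' = max a (t0 - \<epsilon>)" and "b' = min b (t0 + \<epsilon>)"
  have sub: "{a'..b'} \<subseteq> {a..b}" "\<And>t. t \<in> {a'..b'} \<Longrightarrow> \<bar>t - t0\<bar> \<le> \<epsilon>" "t0 \<in> {a'..b'}"
    using t0 \<epsilon> by (auto simp: a'_def b'_def)
  have "x t = z t" if t: "t \<in> {a..b}" "\<bar>t - t0\<bar> < \<epsilon>" for t
  proof (rule ode_unique_short[where F="\<lambda>t y. F (t, y)" and L=L])
    show "t0 \<in> {a'..b'}" by (rule sub)
    show "t \<in> {a'..b'}" using t by (auto simp: a'_def b'_def)
    have "(b' - a') * L \<le> (2 * \<epsilon>) * (L + 1)"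
      using r \<epsilon>(1) by (intro mult_mono) (auto simp: a'_def b'_def)
    also have "\<dots> \<le> (2 * (1 / (4 * (L + 1)))) * (L + 1)" using r \<epsilon>(6) by (intro mult_right_mono mult_left_mono) auto
    also have "\<dots> = 1/2" using r by (simp add: field_simps)
    finally show "(b' - a') * L \<le> 1/2" .
    show "norm (F (t, x t) - F (t, z t)) \<le> L * norm (x t - z t)" if t: "t \<in> {a'..b'}" for t
    proof (rule L)
      have *: "t \<in> {a..b}" "\<bar>t - t0\<bar> \<le> \<epsilon>" using sub t by auto
      show "t \<in> {t0-r..t0+r}" using * \<epsilon> by auto
      show "x t \<in> cball (x t0) r" using d1(2)[of t] * \<epsilon> by (simp add: dist_commute)
      show "z t \<in> cball (x t0) r" using d2(2)[of t] * \<epsilon> eq by (simp add: dist_commute)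
    qed
    show "(x has_vector_derivative F (t, x t)) (at t within {a'..b'})" if "t \<in> {a'..b'}" for t
      by (rule has_vector_derivative_within_subset[OF x sub(1)]) (use sub(1) sub(2)[OF that] \<epsilon> that in auto)
    show "(z has_vector_derivative F (t, z t)) (at t within {a'..b'})" if "t \<in> {a'..b'}" for t
      by (rule has_vector_derivative_within_subset[OF z sub(1)]) (use sub(1) sub(2)[OF that] \<epsilon> that in auto)
  qed (use eq r in auto)
  then show ?thesis using that \<epsilon>(1) by blast
qed

text \<open>Bootstrapping: if \<open>z\<close> is of class \<open>Ck\<close>, then so is its
  derivative \<open>F (t, z t)\<close>, which raises the regularity of \<open>z\<close> by
  one.\<close>

lemma ode_solution_Cinf:
  fixes F :: "real \<times> 'e::findim_inner \<Rightarrow> 'e"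
  assumes J: "open J" and F: "Cinf_on W F" and W: "\<And>t. t \<in> J \<Longrightarrow> (t, z t) \<in> W"
    and z: "\<And>t. t \<in> J \<Longrightarrow> (z has_vector_derivative F (t, z t)) (at t)"
  shows "Cinf_on J z"
proof -
  have "Ck_on k J z" for k
  proof (induction k)
    case 0
    show ?case using z by (auto intro!: continuous_at_imp_continuous_on has_vector_derivative_continuous)
  next
    case (Suc k)
    have "Ck_on k J (\<lambda>t. F (t, z t))"
      by (rule Ck_on_compose[OF J, where T=W]) (use W F Suc J in \<open>auto intro: Ck_on_Pair Ck_on_ident simp: Cinf_on_def\<close>)
    then have "Ck_on k J (\<lambda>t. v *\<^sub>R F (t, z t))" for v
      by (intro Ck_on_scaleR J Ck_on_const)
    then show ?case
      using Ck_on_SucI[OF J z[unfolded has_vector_derivative_def]] by blast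
  qed
  then show ?thesis by (simp add: Cinf_on_def)
qed

section \<open>Charts and tangent vectors\<close>

locale manifold =
  fixes A :: "('a::{t2_space,second_countable_topology}, 'e::findim_inner) chart set"
  assumes manifold: "smooth_manifold A"
begin

lemma chart_ex: "\<exists>c\<in>A. p \<in> cdom c"
  using manifold unfolding smooth_manifold_def by blast

lemma is_chart: "c \<in> A \<Longrightarrow> is_chart c"
  using manifold unfolding smooth_manifold_def by blast

lemma open_cdom: "c \<in> A \<Longrightarrow> open (cdom c)"
  and open_cimg: "c \<in> A \<Longrightarrow> open (cimg c)"
  and cont_cmap: "c \<in> A \<Longrightarrow> continuous_on (cdom c) (cmap c)"
  and cont_cinv: "c \<in> A \<Longrightarrow> continuous_on (cimg c) (cinv c)"
  and cinv_cmap: "c \<in> A \<Longrightarrow> p \<in> cdom c \<Longrightarrow> cinv c (cmap c p) = p"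
  and cmap_cinv: "y \<in> cimg c \<Longrightarrow> cmap c (cinv c y) = y"
  and cinv_in: "y \<in> cimg c \<Longrightarrow> cinv c y \<in> cdom c"
  using is_chart[of c] unfolding is_chart_def homeomorphism_def
  by (auto simp: f_inv_into_f inv_into_into)

lemma open_cinv_vimage:
  assumes "c \<in> A" "open V"
  shows "open (cimg c \<inter> cinv c -` V)"
  using continuous_open_preimage[OF cont_cinv[OF assms(1)] open_cimg[OF assms(1)] assms(2)] .

lemma open_cmap_vimage:
  assumes "c \<in> A" "open V"
  shows "open (cdom c \<inter> cmap c -` V)"
  using continuous_open_preimage[OF cont_cmap[OF assms(1)] open_cdom[OF assms(1)] assms(2)] .

lemma overlap_eq:
  assumes "c \<in> A"
  shows "cmap c ` (cdom c \<inter> S) = cimg c \<inter> cinv c -` S"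
  using cinv_cmap[OF assms] by (force simp: cmap_cinv cinv_in)

lemma open_overlap: "c \<in> A \<Longrightarrow> d \<in> A \<Longrightarrow> open (cmap c ` (cdom c \<inter> cdom d))"
  unfolding overlap_eq by (intro open_cinv_vimage open_cdom)

lemma transition_Cinf:
  "c \<in> A \<Longrightarrow> d \<in> A \<Longrightarrow> Cinf_on (cmap c ` (cdom c \<inter> cdom d)) (transition c d)"
  using manifold unfolding smooth_manifold_def by blast

lemma transition_cmap: "c \<in> A \<Longrightarrow> p \<in> cdom c \<Longrightarrow> transition c d (cmap c p) = cmap d p"
  by (simp add: transition_def cinv_cmap)

definition trD :: "('a, 'e) chart \<Rightarrow> ('a, 'e) chart \<Rightarrow> 'a \<Rightarrow> 'e \<Rightarrow> 'e" where
  "trD c d p = frechet_derivative (transition c d) (at (cmap c p))"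

lemma trD_has_derivative:
  assumes "c \<in> A" "d \<in> A" "p \<in> cdom c" "p \<in> cdom d"
  shows "(transition c d has_derivative trD c d p) (at (cmap c p))"
  unfolding trD_def using Cinf_on_has_derivative[OF transition_Cinf[OF assms(1,2)]] assms(3,4) by blast

lemma trD_linear:
  assumes "c \<in> A" "d \<in> A" "p \<in> cdom c" "p \<in> cdom d"
  shows "linear (trD c d p)"
  using trD_has_derivative[OF assms] by (rule has_derivative_linear)

text \<open>Passing from \<open>c\<close> to \<open>e\<close> through \<open>d\<close> agrees with
  the direct coordinate change on the overlap of \<open>c\<close> and \<open>d\<close>, an open set
  around the point, so this is the chain rule.\<close>

lemma trD_cocycle:
  assumes A: "c \<in> A" "d \<in> A" "e \<in> A" and p: "p \<in> cdom c" "p \<in> cdom d" "p \<in> cdom e"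
  shows "trD d e p (trD c d p u) = trD c e p u"
proof -
  have "(transition d e has_derivative trD d e p) (at (transition c d (cmap c p)))"
    using trD_has_derivative[OF A(2,3) p(2,3)] transition_cmap[OF A(1) p(1)] by simp
  from has_derivative_compose[OF trD_has_derivative[OF A(1,2) p(1,2)] this]
  have "((\<lambda>y. transition d e (transition c d y)) has_derivative (\<lambda>u. trD d e p (trD c d p u))) (at (cmap c p))" .
  then have "(transition c e has_derivative (\<lambda>u. trD d e p (trD c d p u))) (at (cmap c p))"
    by (rule has_derivative_transform_within_open[OF _ open_overlap[OF A(1,2)]])
      (use A p in \<open>auto simp: transition_def cinv_cmap\<close>)
  from frechet_derivative_at[OF this] show ?thesis unfolding trD_def[of c e] by metis
qed

lemma trD_self:
  assumes A: "c \<in> A" and p: "p \<in> cdom c"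
  shows "trD c c p u = u"
proof -
  have "((\<lambda>y. y) has_derivative (\<lambda>u. u)) (at (cmap c p))" by simp
  then have "(transition c c has_derivative (\<lambda>u. u)) (at (cmap c p))"
    by (rule has_derivative_transform_within_open[OF _ open_cimg[OF A]])
      (use A p in \<open>auto simp: transition_def cinv_cmap\<close>)
  from frechet_derivative_at[OF this] show ?thesis unfolding trD_def by metis
qed

lemma tangent_spaceD:
  "v \<in> tangent_space A p \<Longrightarrow> c \<in> A \<Longrightarrow> d \<in> A \<Longrightarrow> p \<in> cdom c \<Longrightarrow> p \<in> cdom d \<Longrightarrow> v d = trD c d p (v c)"
  unfolding tangent_space_def trD_def by blast

lemma tangent_space_off: "v \<in> tangent_space A p \<Longrightarrow> d \<notin> A \<or> p \<notin> cdom d \<Longrightarrow> v d = 0"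
  unfolding tangent_space_def by blast

lemma tangent_spaceI:
  assumes "\<And>c d. c \<in> A \<Longrightarrow> d \<in> A \<Longrightarrow> p \<in> cdom c \<Longrightarrow> p \<in> cdom d \<Longrightarrow> v d = trD c d p (v c)"
    and "\<And>c. c \<notin> A \<or> p \<notin> cdom c \<Longrightarrow> v c = 0"
  shows "v \<in> tangent_space A p"
  using assms unfolding tangent_space_def trD_def by blast

lemma tangent_of_eq:
  "tangent_of A c p u = (\<lambda>d. if d \<in> A \<and> p \<in> cdom d then trD c d p u else 0)"
  unfolding tangent_of_def trD_def ..

lemma tangent_of_in:
  assumes "c \<in> A" "p \<in> cdom c"
  shows "tangent_of A c p u \<in> tangent_space A p"
  by (rule tangent_spaceI) (use assms trD_cocycle in \<open>auto simp: tangent_of_eq\<close>)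

lemma tangent_of_self:
  assumes "c \<in> A" "p \<in> cdom c"
  shows "tangent_of A c p u c = u"
  using assms by (simp add: tangent_of_eq trD_self)

lemma tangent_of_coord:
  assumes "c \<in> A" "p \<in> cdom c" and v: "v \<in> tangent_space A p"
  shows "tangent_of A c p (v c) = v"
proof
  fix d
  show "tangent_of A c p (v c) d = v d"
    using tangent_spaceD[OF v assms(1) _ assms(2), of d] tangent_space_off[OF v, of d]
    by (cases "d \<in> A \<and> p \<in> cdom d") (auto simp: tangent_of_eq)
qed

lemma tangent_of_linear:
  assumes "c \<in> A" "p \<in> cdom c"
  shows "tangent_of A c p (a *\<^sub>R u + w) = (\<lambda>d. a *\<^sub>R tangent_of A c p u d + tangent_of A c p w d)"
  using trD_linear[OF assms(1) _ assms(2)] by (auto simp: tangent_of_eq linear_add linear_scale)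

lemma tangent_zero: "(\<lambda>_. 0) \<in> tangent_space A p"
  by (rule tangent_spaceI) (use linear_0[OF trD_linear] in auto)

text \<open>\<open>differential\<close> is computed in an arbitrarily chosen chart; the chain rule
  cancels that choice against the transformation law of tangent vectors.\<close>

lemma differential_chart:
  assumes c: "c \<in> A" "p \<in> cdom c" and f: "(f \<circ> cinv c) differentiable (at (cmap c p))"
    and w: "w \<in> tangent_space A p"
  shows "differential A f p w = frechet_derivative (f \<circ> cinv c) (at (cmap c p)) (w c)"
proof -
  define d where "d = (SOME d. d \<in> A \<and> p \<in> cdom d)"
  have "d \<in> A \<and> p \<in> cdom d" unfolding d_def by (rule someI_ex) (use chart_ex in blast)
  then have d: "d \<in> A" "p \<in> cdom d" by auto
  let ?D = "frechet_derivative (f \<circ> cinv c) (at (cmap c p))"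
  have "(f \<circ> cinv c has_derivative ?D) (at (transition d c (cmap d p)))"
    using f by (simp add: transition_cmap d frechet_derivative_works[symmetric])
  from has_derivative_compose[OF trD_has_derivative[OF d(1) c(1) d(2) c(2)] this]
  have "((\<lambda>y. (f \<circ> cinv c) (transition d c y)) has_derivative (\<lambda>u. ?D (trD d c p u))) (at (cmap d p))" .
  then have "(f \<circ> cinv d has_derivative (\<lambda>u. ?D (trD d c p u))) (at (cmap d p))"
    by (rule has_derivative_transform_within_open[OF _ open_overlap[OF d(1) c(1)]])
      (use c d in \<open>auto simp: transition_def cinv_cmap\<close>)
  from frechet_derivative_at[OF this, symmetric]
  have "differential A f p w = ?D (trD d c p (w d))"
    by (simp add: differential_def d_def[symmetric] Let_def)
  then show ?thesis using tangent_spaceD[OF w d(1) c(1) d(2) c(2)] by simp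
qed

lemma differential_local:
  assumes "open N" "p \<in> N" "\<And>q. q \<in> N \<Longrightarrow> f q = g q"
  shows "differential A f p = differential A g p"
proof -
  define d where "d = (SOME d. d \<in> A \<and> p \<in> cdom d)"
  have "d \<in> A \<and> p \<in> cdom d" unfolding d_def by (rule someI_ex) (use chart_ex in blast)
  then have d: "d \<in> A" "p \<in> cdom d" by auto
  have "frechet_derivative (f \<circ> cinv d) (at (cmap d p)) = frechet_derivative (g \<circ> cinv d) (at (cmap d p))"
    by (rule frechet_derivative_local[OF open_cinv_vimage[OF d(1) assms(1)]])
      (use d assms in \<open>auto simp: cinv_cmap\<close>)
  then show ?thesis by (auto simp: differential_def d_def[symmetric] Let_def)
qed

end

section \<open>Hamiltonian vector fields\<close>

text \<open>Collects what the theory of integral curves takes from a vector field. Testing the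
  \<open>c\<close>-component in the chart \<open>c\<close> suffices, because it determines the
  tangent vector at the points of \<open>cdom c\<close>.\<close>

definition smooth_field ::
  "('a, 'e::real_normed_vector) chart set \<Rightarrow> (real \<Rightarrow> 'a \<Rightarrow> ('a, 'e) tvec) \<Rightarrow> bool" where
  "smooth_field A V \<longleftrightarrow> (\<forall>t\<in>{0..1}. \<forall>p. V t p \<in> tangent_space A p) \<and>
     (\<forall>c\<in>A. smooth_on ({0..1} \<times> cimg c) (\<lambda>(t, y). V t (cinv c y) c))"

locale symplectic = manifold A
  for A :: "('a::{t2_space,second_countable_topology}, 'e::findim_inner) chart set" +
  fixes \<omega> :: "('a, 'e) two_form"
  assumes form: "smooth_two_form A \<omega>" and nondeg: "nondegenerate_two_form A \<omega>"
begin

lemma form_left: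
  assumes "v \<in> tangent_space A p" "w \<in> tangent_space A p" "z \<in> tangent_space A p"
  shows "\<omega> p (\<lambda>c. a *\<^sub>R v c + w c) z = a * \<omega> p v z + \<omega> p w z"
  using form assms unfolding smooth_two_form_def by blast

lemma form_right:
  assumes "v \<in> tangent_space A p" "w \<in> tangent_space A p" "z \<in> tangent_space A p"
  shows "\<omega> p z (\<lambda>c. a *\<^sub>R v c + w c) = a * \<omega> p z v + \<omega> p z w"
  using form assms unfolding smooth_two_form_def by blast

lemma linear_form_coord_left:
  assumes "c \<in> A" "y \<in> cimg c"
  shows "linear (\<lambda>u. form_coord A \<omega> c u w y)"
proof -
  let ?p = "cinv c y"
  have t: "tangent_of A c ?p u \<in> tangent_space A ?p" for u
    using tangent_of_in[OF assms(1) cinv_in[OF assms(2)]] .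
  have *: "form_coord A \<omega> c (a *\<^sub>R u + v) w y = a * form_coord A \<omega> c u w y + form_coord A \<omega> c v w y" for a u v
    unfolding form_coord_def tangent_of_linear[OF assms(1) cinv_in[OF assms(2)]]
    by (rule form_left[OF t t t])
  show ?thesis
    \<comment> \<open>The instance with both vectors 0 shows that the value at 0 is 0, so that the
      instance with second vector 0 becomes homogeneity.\<close>
    by (rule linearI) (use *[of 1] *[of _ _ 0] *[of 1 0 0] in auto)
qed

lemma linear_form_coord_right:
  assumes "c \<in> A" "y \<in> cimg c"
  shows "linear (\<lambda>u. form_coord A \<omega> c w u y)"
proof -
  let ?p = "cinv c y"
  have t: "tangent_of A c ?p u \<in> tangent_space A ?p" for u
    using tangent_of_in[OF assms(1) cinv_in[OF assms(2)]] .
  have *: "form_coord A \<omega> c w (a *\<^sub>R u + v) y = a * form_coord A \<omega> c w u y + form_coord A \<omega> c w v y" for a u v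
    unfolding form_coord_def tangent_of_linear[OF assms(1) cinv_in[OF assms(2)]]
    by (rule form_right[OF t t t])
  show ?thesis
    by (rule linearI) (use *[of 1] *[of _ _ 0] *[of 1 0 0] in auto)
qed

lemma form_coord_eq:
  assumes "c \<in> A" "p \<in> cdom c" "v \<in> tangent_space A p" "w \<in> tangent_space A p"
  shows "form_coord A \<omega> c (v c) (w c) (cmap c p) = \<omega> p v w"
  using assms by (simp add: form_coord_def cinv_cmap tangent_of_coord)

text \<open>The map \<open>u \<mapsto> \<omega>(u, \<cdot>)\<close> in a chart, with covectors identified with vectors by the inner product.\<close>

definition musical :: "('a, 'e) chart \<Rightarrow> 'e \<Rightarrow> 'e \<Rightarrow> 'e" where
  "musical c y u = (\<Sum>b\<in>onb. form_coord A \<omega> c u b y *\<^sub>R b)"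

lemma musical_inner:
  assumes "c \<in> A" "y \<in> cimg c"
  shows "musical c y u \<bullet> w = form_coord A \<omega> c u w y"
proof -
  have "musical c y u \<bullet> w = (\<Sum>b\<in>onb. form_coord A \<omega> c u b y * (b \<bullet> w))"
    by (simp add: musical_def inner_sum_left)
  also have "\<dots> = form_coord A \<omega> c u w y"
    using linear_onb[OF linear_form_coord_right[OF assms], of u w] by (simp add: inner_commute mult.commute)
  finally show ?thesis .
qed

lemma musical_linear:
  assumes "c \<in> A" "y \<in> cimg c"
  shows "linear (musical c y)"
proof -
  note lin = linear_form_coord_left[OF assms]
  show ?thesis unfolding musical_def
    by (rule linearI)
      (simp_all add: linear_add[OF lin] linear_scale[OF lin] scaleR_add_left sum.distrib scaleR_sum_right)
qed

text \<open>A vector in the kernel represents a tangent vector that pairs to 0 with every other one;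
  this is where nondegeneracy becomes invertibility of a linear map of the model space.\<close>

lemma musical_inj:
  assumes "c \<in> A" "y \<in> cimg c" "musical c y u = 0"
  shows "u = 0"
proof -
  let ?p = "cinv c y" and ?v = "tangent_of A c (cinv c y) u"
  have p: "?p \<in> cdom c" "cmap c ?p = y" using assms cinv_in cmap_cinv by auto
  have v: "?v \<in> tangent_space A ?p" using tangent_of_in[OF assms(1) p(1)] .
  have "\<omega> ?p ?v w = 0" if "w \<in> tangent_space A ?p" for w
    using form_coord_eq[OF assms(1) p(1) v that] musical_inner[OF assms(1,2), of u "w c"] assms(3) p
    by (simp add: tangent_of_self assms(1))
  then have "?v = (\<lambda>_. 0)" using nondeg v unfolding nondegenerate_two_form_def by blast
  then show ?thesis using tangent_of_self[OF assms(1) p(1), of u] by simp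
qed

lemma musical_Cinf:
  assumes "c \<in> A"
  shows "Cinf_on (cimg c) (\<lambda>y. musical c y u)"
proof -
  have "Cinf_on (cimg c) (form_coord A \<omega> c u b)" for b
    using form assms unfolding smooth_two_form_def by blast
  then show ?thesis unfolding Cinf_on_def musical_def
    by (intro allI Ck_on_sum Ck_on_scaleR Ck_on_const open_cimg assms) auto
qed

text \<open>The difference of two candidates pairs to 0 with every tangent vector, so nondegeneracy
  makes them equal and the definite description is usable.\<close>

lemma hamiltonian_vf_unique:
  assumes "v \<in> tangent_space A p" "\<And>w. w \<in> tangent_space A p \<Longrightarrow> \<omega> p v w = differential A f p w"
  shows "hamiltonian_vf A \<omega> f p = v"
  unfolding hamiltonian_vf_def
proof (rule the_equality)
  show "v \<in> tangent_space A p \<and> (\<forall>w\<in>tangent_space A p. \<omega> p v w = differential A f p w)" using assms by blast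
  fix v' assume v': "v' \<in> tangent_space A p \<and> (\<forall>w\<in>tangent_space A p. \<omega> p v' w = differential A f p w)"
  let ?d = "\<lambda>c. (-1) *\<^sub>R v' c + v c"
  have "\<omega> p ?d w = 0" if "w \<in> tangent_space A p" for w
    using form_left[of v' p v w "-1"] assms v' that by simp
  moreover have "?d \<in> tangent_space A p"
  proof (rule tangent_spaceI)
    fix c d assume cd: "c \<in> A" "d \<in> A" "p \<in> cdom c" "p \<in> cdom d"
    show "?d d = trD c d p (?d c)"
      using tangent_spaceD[OF assms(1) cd] tangent_spaceD[OF conjunct1[OF v'] cd]
        linear_diff[OF trD_linear[OF cd], of "v c" "v' c"] by simp
  qed (use tangent_space_off[OF assms(1)] tangent_space_off[OF conjunct1[OF v']] in simp)
  ultimately have "?d = (\<lambda>_. 0)" using nondeg unfolding nondegenerate_two_form_def by blast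
  then show "v' = v" by (auto simp: fun_eq_iff)
qed

text \<open>The right-hand side of the second claim is the coordinate gradient of \<open>f\<close>.
  An injective endomorphism is onto, so a coordinate vector solving this system exists; the claim
  exhibits the field as the solution of a linear system.\<close>

lemma hamiltonian_vf_coord:
  assumes c: "c \<in> A" "p \<in> cdom c" and f: "(f \<circ> cinv c) differentiable (at (cmap c p))"
  shows "hamiltonian_vf A \<omega> f p \<in> tangent_space A p"
    and "musical c (cmap c p) (hamiltonian_vf A \<omega> f p c) =
      (\<Sum>b\<in>onb. frechet_derivative (f \<circ> cinv c) (at (cmap c p)) b *\<^sub>R b)"
proof -
  let ?y = "cmap c p" let ?D = "frechet_derivative (f \<circ> cinv c) (at ?y)"
  have y: "?y \<in> cimg c" using c by blast
  obtain u where u: "musical c ?y u = (\<Sum>b\<in>onb. ?D b *\<^sub>R b)"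
    using linear_inj_imp_surj_findim[OF musical_linear[OF c(1) y] musical_inj[OF c(1) y]] by blast
  have lin: "linear ?D" using f by (simp add: frechet_derivative_works has_derivative_linear)
  define v where "v = tangent_of A c p u"
  have v: "v \<in> tangent_space A p" "v c = u"
    using tangent_of_in tangent_of_self c by (auto simp: v_def)
  have "hamiltonian_vf A \<omega> f p = v"
  proof (rule hamiltonian_vf_unique[OF v(1)])
    fix w assume w: "w \<in> tangent_space A p"
    have "\<omega> p v w = (\<Sum>b\<in>onb. ?D b *\<^sub>R b) \<bullet> w c"
      using form_coord_eq[OF c v(1) w] musical_inner[OF c(1) y, of u "w c"] u v(2) by simp
    also have "\<dots> = ?D (w c)"
      using linear_onb[OF lin, of "w c"] by (simp add: inner_sum_left inner_commute[of "w c"] mult.commute)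
    finally show "\<omega> p v w = differential A f p w" using differential_chart[OF c f w] by simp
  qed
  then show "hamiltonian_vf A \<omega> f p \<in> tangent_space A p"
    and "musical c (cmap c p) (hamiltonian_vf A \<omega> f p c) = (\<Sum>b\<in>onb. ?D b *\<^sub>R b)"
    using u v by auto
qed

lemma hamiltonian_vf_local:
  assumes "open N" "p \<in> N" "\<And>q. q \<in> N \<Longrightarrow> f q = g q"
  shows "hamiltonian_vf A \<omega> f p = hamiltonian_vf A \<omega> g p"
proof -
  have "differential A f p = differential A g p" by (rule differential_local[OF assms])
  then show ?thesis by (simp add: hamiltonian_vf_def)
qed

lemma hamiltonian_vf_zero: "hamiltonian_vf A \<omega> (\<lambda>_. 0) p = (\<lambda>_. 0)"
proof (rule hamiltonian_vf_unique[OF tangent_zero])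
  fix w assume w: "w \<in> tangent_space A p"
  have "\<omega> p (\<lambda>c. (-1) *\<^sub>R (0::'e) + 0) w = (-1) * \<omega> p (\<lambda>_. 0) w + \<omega> p (\<lambda>_. 0) w"
    by (rule form_left[OF tangent_zero tangent_zero w])
  then have "\<omega> p (\<lambda>_. 0) w = 0" by simp
  moreover have "differential A (\<lambda>_. 0) p w = 0"
    unfolding differential_def Let_def o_def by simp
  ultimately show "\<omega> p (\<lambda>_. 0) w = differential A (\<lambda>_. 0) p w" by simp
qed

text \<open>In a chart the field solves a linear system with coefficient map \<open>musical\<close>
  and the spatial gradient of the Hamiltonian on the right. Solving it for a local smooth extension
  \<open>g\<close> of \<open>H\<close> yields a smooth \<open>F\<close> on an open set of times and
  coordinates that restricts to the field.\<close>

lemma smooth_field_hamiltonian_vf: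
  assumes H: "smooth_hamiltonian A H"
  shows "smooth_field A (\<lambda>t. hamiltonian_vf A \<omega> (H t))"
proof -
  have key: "\<exists>W F. open W \<and> (t0, y0) \<in> W \<and> Cinf_on W F \<and>
    (\<forall>q\<in>W \<inter> ({0..1} \<times> cimg c). F q = (\<lambda>(t, y). hamiltonian_vf A \<omega> (H t) (cinv c y) c) q) \<and>
    (\<forall>(t,y)\<in>W \<inter> ({0..1} \<times> cimg c). (H t \<circ> cinv c) differentiable (at y))"
    if c: "c \<in> A" and p: "(t0, y0) \<in> {0..1} \<times> cimg c" for c t0 y0
  proof -
    have "smooth_on ({0..1} \<times> cimg c) (\<lambda>(t, y). H t (cinv c y))"
      using H c unfolding smooth_hamiltonian_def by blast
    then obtain W0 g where W0: "open W0" "(t0, y0) \<in> W0" "Cinf_on W0 g"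
      and eq0: "\<forall>q\<in>W0 \<inter> ({0..1} \<times> cimg c). g q = (\<lambda>(t, y). H t (cinv c y)) q"
      using p unfolding smooth_on_def by blast
    have eq: "g (t, y) = H t (cinv c y)" if "(t, y) \<in> W0" "t \<in> {0..1}" "y \<in> cimg c" for t y
      using bspec[OF eq0, of "(t, y)"] that by simp
    \<comment> \<open>Confined to the chart image, where \<open>musical\<close> is linear and
      injective, so that the system can be solved at every point of \<open>W\<close>.\<close>
    define W where "W = W0 \<inter> (UNIV \<times> cimg c)"
    have W: "open W" "(t0, y0) \<in> W" "W \<subseteq> W0" "\<And>q. q \<in> W \<Longrightarrow> snd q \<in> cimg c"
      using W0 p open_cimg[OF c] by (auto simp: W_def intro!: open_Times)
    have g: "Cinf_on W g" using W0(3) W(3) Cinf_on_subset by blast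
    \<comment> \<open>The spatial gradient of the extension: the directions \<open>(0, b)\<close>
      leave time fixed. It also makes sense at times outside \<open>{0..1}\<close>.\<close>
    define G where "G q = (\<Sum>b\<in>onb. frechet_derivative g (at q) (0, b) *\<^sub>R b)" for q :: "real \<times> 'e"
    have "\<exists>u. musical c (snd q) u = G q" if "q \<in> W" for q
      using linear_inj_imp_surj_findim[OF musical_linear[OF c W(4)[OF that]] musical_inj[OF c W(4)[OF that]]] .
    then obtain F where F: "\<And>q. q \<in> W \<Longrightarrow> musical c (snd q) (F q) = G q" by metis
    have snd: "Cinf_on W (\<lambda>q. snd q)"
      unfolding Cinf_on_def using Ck_on_bounded_linear[OF bounded_linear_snd W(1) Ck_on_ident[OF W(1)]] by blast
    have L: "Cinf_on W (\<lambda>q. musical c (snd q) u)" for u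
      by (rule Cinf_on_compose[OF W(1) _ snd musical_Cinf[OF c]]) (use W(4) in auto)
    have "Ck_on k W G" for k
      unfolding G_def using Cinf_on_derivative[OF g]
      by (intro Ck_on_sum Ck_on_scaleR Ck_on_const W(1)) (auto simp: Cinf_on_def)
    then have "Ck_on k W F" for k
      by (intro Ck_on_linear_solve[where L="\<lambda>q. musical c (snd q)" and F=F and g=G, OF W(1) L])
        (use musical_linear[OF c W(4)] musical_inj[OF c W(4)] F in auto)
    then have "Cinf_on W F" by (simp add: Cinf_on_def)
    moreover have "F (t, y) = hamiltonian_vf A \<omega> (H t) (cinv c y) c \<and> (H t \<circ> cinv c) differentiable (at y)"
      if q: "(t, y) \<in> W" "t \<in> {0..1}" for t y
    proof -
      let ?p = "cinv c y" let ?W = "(\<lambda>y. (t, y)) -` W"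
      have y: "y \<in> cimg c" using W(4)[OF q(1)] by simp
      have op: "open ?W" by (intro open_vimage W(1) continuous_intros)
      have "(g has_derivative frechet_derivative g (at (t, y))) (at (t, y))"
        using Cinf_on_has_derivative[OF g q(1)] .
      moreover have "((\<lambda>y. (t, y)) has_derivative (\<lambda>h. (0, h))) (at y)"
        by (auto intro!: derivative_eq_intros)
      ultimately have "((\<lambda>y. g (t, y)) has_derivative (\<lambda>h. frechet_derivative g (at (t, y)) (0, h))) (at y)"
        by (rule has_derivative_compose[rotated])
      then have d: "(H t \<circ> cinv c has_derivative (\<lambda>h. frechet_derivative g (at (t, y)) (0, h))) (at y)"
        by (rule has_derivative_transform_within_open[OF _ op])
          (use q eq W(3,4) in \<open>fastforce+\<close>)
      have yp: "cmap c ?p = y" using cmap_cinv[OF y] .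
      have df: "(H t \<circ> cinv c) differentiable (at (cmap c ?p))"
        using d yp unfolding differentiable_def by auto
      have "musical c y (hamiltonian_vf A \<omega> (H t) ?p c) = musical c y (F (t, y))"
        using hamiltonian_vf_coord(2)[OF c cinv_in[OF y] df] F[OF q(1)] frechet_derivative_at[OF d, symmetric] yp
        by (simp add: G_def)
      then have "musical c y (F (t, y) - hamiltonian_vf A \<omega> (H t) ?p c) = 0"
        using linear_diff[OF musical_linear[OF c y]] by simp
      from musical_inj[OF c y this] show ?thesis using df yp by simp
    qed
    ultimately show ?thesis using W(1,2) by (intro exI[of _ W] exI[of _ F]) auto
  qed
  have "hamiltonian_vf A \<omega> (H t) p \<in> tangent_space A p" if t: "t \<in> {0..1}" for t p
  proof -
    obtain c where c: "c \<in> A" "p \<in> cdom c" using chart_ex by blast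
    then have "(t, cmap c p) \<in> {0..1} \<times> cimg c" using t by blast
    from key[OF c(1) this] have "(H t \<circ> cinv c) differentiable (at (cmap c p))" using t c by blast
    then show ?thesis using hamiltonian_vf_coord(1)[OF c] by blast
  qed
  moreover have "smooth_on ({0..1} \<times> cimg c) (\<lambda>(t, y). hamiltonian_vf A \<omega> (H t) (cinv c y) c)"
    if c: "c \<in> A" for c
    unfolding smooth_on_def using key[OF c] by (metis surj_pair)
  ultimately show ?thesis unfolding smooth_field_def by blast
qed

end

section \<open>Integral curves\<close>

text \<open>Smoothness in time is not required, so that integral curves can be glued; it follows from the
  differential equation if the field is smooth.\<close>

definition integral_curve :: "('a::topological_space, 'e::real_normed_vector) chart set \<Rightarrow>
    (real \<Rightarrow> 'a \<Rightarrow> ('a, 'e) tvec) \<Rightarrow> real set \<Rightarrow> (real \<Rightarrow> 'a) \<Rightarrow> bool" where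
  "integral_curve A V I x \<longleftrightarrow> continuous_on I x \<and>
     (\<forall>s\<in>I. \<forall>c\<in>A. x s \<in> cdom c \<longrightarrow>
        ((cmap c \<circ> x) has_vector_derivative V s (x s) c) (at s within I))"

lemma integral_curve_subset:
  assumes "integral_curve A V I x" "J \<subseteq> I"
  shows "integral_curve A V J x"
  using assms unfolding integral_curve_def
  by (meson continuous_on_subset has_vector_derivative_within_subset subsetD)

lemma has_vector_derivative_Un:
  assumes "(f has_vector_derivative d) (at x within S)" "(f has_vector_derivative d) (at x within T)"
  shows "(f has_vector_derivative d) (at x within (S \<union> T))"
  using assms unfolding has_vector_derivative_def has_derivative_within
  by (auto intro: Lim_Un)

text \<open>Away from a closed set the filter is trivial and every vector is a derivative. This lets
  the gluing argument treat all times alike.\<close>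

lemma has_vector_derivative_outside_closed:
  assumes "closed S" "s \<notin> S"
  shows "(f has_vector_derivative D) (at s within S)"
proof -
  have "trivial_limit (at s within S)" using assms by (intro not_in_closure_trivial_limitI) simp
  then have "at s within S = bot" by simp
  then show ?thesis
    by (simp add: has_vector_derivative_def has_derivative_def bounded_linear_scaleR_left)
qed

text \<open>At the joint both one-sided derivatives equal the value of the field at the common
  point, so they combine to a derivative within the union.\<close>

lemma integral_curve_glue:
  assumes x: "integral_curve A V {a..b} x" and z: "integral_curve A V {b..d} z"
    and eq: "x b = z b" and ab: "a \<le> b" "b \<le> d"
  shows "integral_curve A V {a..d} (\<lambda>t. if t \<le> b then x t else z t)"
proof -
  let ?w = "\<lambda>t. if t \<le> b then x t else z t"
  have I: "{a..d} = {a..b} \<union> {b..d}" using ab by auto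
  have wx: "?w t = x t" if "t \<in> {a..b}" for t using that by simp
  have wz: "?w t = z t" if "t \<in> {b..d}" for t using that eq by auto
  have "continuous_on {a..b} ?w"
    by (rule continuous_on_eq[of _ x]) (use x wx in \<open>auto simp: integral_curve_def\<close>)
  moreover have "continuous_on {b..d} ?w"
    by (rule continuous_on_eq[of _ z]) (use z wz in \<open>auto simp: integral_curve_def\<close>)
  ultimately have "continuous_on {a..d} ?w" unfolding I by (intro continuous_on_closed_Un) auto
  moreover have "((cmap c \<circ> ?w) has_vector_derivative V s (?w s) c) (at s within {a..d})"
    if s: "s \<in> {a..d}" and c: "c \<in> A" "?w s \<in> cdom c" for s c
  proof -
    have 1: "((cmap c \<circ> ?w) has_vector_derivative V s (?w s) c) (at s within {a..b})" if "s \<in> {a..b}"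
    proof -
      have "((cmap c \<circ> x) has_vector_derivative V s (?w s) c) (at s within {a..b})"
        using x that c wx[OF that] unfolding integral_curve_def by simp
      then show ?thesis by (rule has_vector_derivative_transform[OF that, rotated]) (use wx in simp)
    qed
    have 2: "((cmap c \<circ> ?w) has_vector_derivative V s (?w s) c) (at s within {b..d})" if "s \<in> {b..d}"
    proof -
      have "((cmap c \<circ> z) has_vector_derivative V s (?w s) c) (at s within {b..d})"
        using z that c wz[OF that] unfolding integral_curve_def by simp
      then show ?thesis by (rule has_vector_derivative_transform[OF that, rotated]) (use wz in simp)
    qed
    note vac = has_vector_derivative_outside_closed[OF closed_atLeastAtMost]
    show ?thesis unfolding I
      by (rule has_vector_derivative_Un) (use 1 2 vac in blast)+
  qed
  ultimately show ?thesis unfolding integral_curve_def by blast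
qed

context manifold begin

lemma smooth_field_tangent: "smooth_field A V \<Longrightarrow> t \<in> {0..1} \<Longrightarrow> V t p \<in> tangent_space A p"
  unfolding smooth_field_def by blast

text \<open>\<open>W\<close> is shrunk to points over the chart image so that solutions of the
  extended equation can be carried back to the manifold by \<open>cinv c\<close>.\<close>

lemma smooth_field_extension:
  assumes "smooth_field A V" "c \<in> A" "t0 \<in> {0..1}" "y0 \<in> cimg c"
  obtains W F where "open W" "(t0, y0) \<in> W" "Cinf_on W F" "\<And>q. q \<in> W \<Longrightarrow> snd q \<in> cimg c"
    "\<And>t y. (t, y) \<in> W \<Longrightarrow> t \<in> {0..1} \<Longrightarrow> F (t, y) = V t (cinv c y) c"
proof -
  have "smooth_on ({0..1} \<times> cimg c) (\<lambda>(t, y). V t (cinv c y) c)"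
    using assms unfolding smooth_field_def by blast
  moreover have "(t0, y0) \<in> {0..1} \<times> cimg c" using assms by blast
  ultimately obtain W F where W: "open W" "(t0, y0) \<in> W" "Cinf_on W F"
    and eq0: "\<forall>q\<in>W \<inter> ({0..1} \<times> cimg c). F q = (\<lambda>(t, y). V t (cinv c y) c) q"
    unfolding smooth_on_def by blast
  let ?W = "W \<inter> (UNIV \<times> cimg c)"
  show ?thesis
  proof (rule that[of ?W F])
    show "open ?W" using W open_cimg[OF assms(2)] by (intro open_Int open_Times) auto
    show "Cinf_on ?W F" using W(3) by (rule Cinf_on_subset) auto
    show "F (t, y) = V t (cinv c y) c" if "(t, y) \<in> ?W" "t \<in> {0..1}" for t y
      using bspec[OF eq0, of "(t, y)"] that by simp
  qed (use W assms in auto)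
qed

text \<open>Integral curves must satisfy their equation in every chart, whereas they are constructed
  in one. Continuity keeps the curve in \<open>cdom c\<close> near \<open>s\<close>, where the
  transition map converts the equation.\<close>

lemma has_vector_derivative_change_chart:
  assumes c: "c \<in> A" "x s \<in> cdom c" and d: "d \<in> A" "x s \<in> cdom d" and s: "s \<in> I"
    and x: "continuous (at s within I) x" and v: "v \<in> tangent_space A (x s)"
    and D: "((cmap c \<circ> x) has_vector_derivative v c) (at s within I)"
  shows "((cmap d \<circ> x) has_vector_derivative v d) (at s within I)"
proof -
  have "(transition c d has_derivative trD c d (x s)) (at ((cmap c \<circ> x) s))"
    using trD_has_derivative[OF c(1) d(1) c(2) d(2)] by simp
  from has_derivative_compose[OF D[unfolded has_vector_derivative_def] this]
  have "((\<lambda>t. transition c d ((cmap c \<circ> x) t)) has_vector_derivative v d) (at s within I)"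
    using tangent_spaceD[OF v c(1) d(1) c(2) d(2)] linear_scale[OF trD_linear[OF c(1) d(1) c(2) d(2)]]
    by (simp add: has_vector_derivative_def)
  moreover have "\<forall>\<^sub>F t in at s within I. x t \<in> cdom c"
    using x open_cdom[OF c(1)] c(2) unfolding continuous_within by (rule topological_tendstoD)
  then have "\<forall>\<^sub>F t in at s within I. transition c d ((cmap c \<circ> x) t) = (cmap d \<circ> x) t"
    by eventually_elim (simp add: transition_cmap c)
  ultimately show ?thesis
    unfolding has_vector_derivative_def
    by (rule has_derivative_transform_eventually) (use c s in \<open>auto simp: transition_cmap\<close>)
qed

lemma integral_curve_in_chart:
  assumes V: "smooth_field A V" and x: "integral_curve A V {a..b} x" and ab: "{a..b} \<subseteq> {0..1}"
    and t0: "t0 \<in> {a..b}" and c: "c \<in> A" "x t0 \<in> cdom c"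
    and W: "open W" "(t0, cmap c (x t0)) \<in> W"
      "\<And>t y. (t, y) \<in> W \<Longrightarrow> t \<in> {0..1} \<Longrightarrow> F (t, y) = V t (cinv c y) c"
  obtains \<eta> where "\<eta> > 0" "\<And>t. t \<in> {a..b} \<Longrightarrow> \<bar>t - t0\<bar> < \<eta> \<Longrightarrow> x t \<in> cdom c \<and>
    ((cmap c \<circ> x) has_vector_derivative F (t, (cmap c \<circ> x) t)) (at t within {a..b})"
proof -
  have "((cmap c \<circ> x) has_vector_derivative V t0 (x t0) c) (at t0 within {a..b})"
    using x t0 c unfolding integral_curve_def by blast
  then have "continuous (at t0 within {a..b}) (\<lambda>t. (t, (cmap c \<circ> x) t))"
    by (intro continuous_Pair continuous_ident has_vector_derivative_continuous)
  then have "\<forall>\<^sub>F t in at t0 within {a..b}. (t, (cmap c \<circ> x) t) \<in> W"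
    using W(1,2) unfolding continuous_within by (auto elim: topological_tendstoD)
  moreover have "continuous (at t0 within {a..b}) x"
    using x t0 unfolding integral_curve_def by (simp add: continuous_on_eq_continuous_within)
  then have "\<forall>\<^sub>F t in at t0 within {a..b}. x t \<in> cdom c"
    using open_cdom[OF c(1)] c(2) unfolding continuous_within by (rule topological_tendstoD)
  ultimately have "\<forall>\<^sub>F t in at t0 within {a..b}. (t, (cmap c \<circ> x) t) \<in> W \<and> x t \<in> cdom c"
    by eventually_elim auto
  then obtain \<eta> where \<eta>: "\<eta> > 0" "\<And>t. t \<in> {a..b} \<Longrightarrow> t \<noteq> t0 \<Longrightarrow> \<bar>t - t0\<bar> < \<eta> \<Longrightarrow> (t, (cmap c \<circ> x) t) \<in> W \<and> x t \<in> cdom c"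
    unfolding eventually_at dist_real_def by metis
  show ?thesis
  proof (rule that[OF \<eta>(1)])
    fix t assume t: "t \<in> {a..b}" "\<bar>t - t0\<bar> < \<eta>"
    then have *: "(t, (cmap c \<circ> x) t) \<in> W" "x t \<in> cdom c" using \<eta>(2)[of t] W(2) c by (cases "t = t0"; auto)+
    have "F (t, (cmap c \<circ> x) t) = V t (x t) c"
      using W(3)[OF *(1)] t ab cinv_cmap[OF c(1) *(2)] by auto
    moreover have "((cmap c \<circ> x) has_vector_derivative V t (x t) c) (at t within {a..b})"
      using x t c *(2) unfolding integral_curve_def by blast
    ultimately show "x t \<in> cdom c \<and> ((cmap c \<circ> x) has_vector_derivative F (t, (cmap c \<circ> x) t)) (at t within {a..b})"
      using *(2) by simp
  qed
qed

text \<open>The set of agreement is closed because the manifold is Hausdorff, and open by uniqueness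
  in a chart; an interval is connected.\<close>

lemma integral_curve_unique:
  assumes V: "smooth_field A V" and x: "integral_curve A V {a..b} x" and z: "integral_curve A V {a..b} z"
    and ab: "{a..b} \<subseteq> {0..1}" and s: "s \<in> {a..b}" "x s = z s" and t: "t \<in> {a..b}"
  shows "x t = z t"
proof -
  define E where "E = {t \<in> {a..b}. x t = z t}"
  have "continuous_on {a..b} (\<lambda>t. (x t, z t))"
    using x z unfolding integral_curve_def by (intro continuous_on_Pair) auto
  from continuous_closedin_preimage[OF this closed_diagonal]
  have "closedin (top_of_set {a..b}) ({a..b} \<inter> (\<lambda>t. (x t, z t)) -` {y. \<exists>x. y = (x, x)})" .
  moreover have "{a..b} \<inter> (\<lambda>t. (x t, z t)) -` {y. \<exists>x. y = (x, x)} = E" by (auto simp: E_def)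
  ultimately have cl: "closedin (top_of_set {a..b}) E" by simp
  have op: "openin (top_of_set {a..b}) E"
    unfolding openin_contains_ball
  proof (intro conjI ballI)
    show "E \<subseteq> {a..b}" by (auto simp: E_def)
    fix t0 assume "t0 \<in> E"
    then have t0: "t0 \<in> {a..b}" "x t0 = z t0" by (auto simp: E_def)
    obtain c where c: "c \<in> A" "x t0 \<in> cdom c" using chart_ex by blast
    then have c': "z t0 \<in> cdom c" "cmap c (x t0) \<in> cimg c" using t0 by auto
    have t01: "t0 \<in> {0..1}" using t0 ab by blast
    obtain W F where W: "open W" "(t0, cmap c (x t0)) \<in> W" "Cinf_on W F" and Wc: "\<And>q. q \<in> W \<Longrightarrow> snd q \<in> cimg c"
      and WV: "\<And>t y. (t, y) \<in> W \<Longrightarrow> t \<in> {0..1} \<Longrightarrow> F (t, y) = V t (cinv c y) c"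
      using smooth_field_extension[OF V c(1) t01 c'(2)] by blast
    obtain \<eta>1 where \<eta>1: "\<eta>1 > 0" "\<And>t. t \<in> {a..b} \<Longrightarrow> \<bar>t - t0\<bar> < \<eta>1 \<Longrightarrow> x t \<in> cdom c \<and>
      ((cmap c \<circ> x) has_vector_derivative F (t, (cmap c \<circ> x) t)) (at t within {a..b})"
      using integral_curve_in_chart[OF V x ab t0(1) c W(1,2) WV] by blast
    have W2: "(t0, cmap c (z t0)) \<in> W" using W(2) t0(2) by simp
    obtain \<eta>2 where \<eta>2: "\<eta>2 > 0" "\<And>t. t \<in> {a..b} \<Longrightarrow> \<bar>t - t0\<bar> < \<eta>2 \<Longrightarrow> z t \<in> cdom c \<and>
      ((cmap c \<circ> z) has_vector_derivative F (t, (cmap c \<circ> z) t)) (at t within {a..b})"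
      using integral_curve_in_chart[OF V z ab t0(1) c(1) c'(1) W(1) W2 WV] by blast
    define \<eta> where "\<eta> = min \<eta>1 \<eta>2"
    have \<eta>: "\<eta> > 0" "\<eta> \<le> \<eta>1" "\<eta> \<le> \<eta>2" using \<eta>1(1) \<eta>2(1) by (auto simp: \<eta>_def)
    have W3: "(t0, (cmap c \<circ> x) t0) \<in> W" using W(2) by simp
    obtain \<epsilon> where \<epsilon>: "\<epsilon> > 0" "\<And>t. t \<in> {a..b} \<Longrightarrow> \<bar>t - t0\<bar> < \<epsilon> \<Longrightarrow> (cmap c \<circ> x) t = (cmap c \<circ> z) t"
      by (rule ode_unique_local[where x="cmap c \<circ> x" and z="cmap c \<circ> z", OF W(1,3) W3 \<eta>(1) t0(1)])
        (use \<eta>1(2) \<eta>2(2) \<eta> t0(2) in auto)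
    have "x t = z t" if "t \<in> {a..b}" "\<bar>t - t0\<bar> < min \<epsilon> \<eta>" for t
    proof -
      have "x t \<in> cdom c" "z t \<in> cdom c" using \<eta>1(2)[of t] \<eta>2(2)[of t] that \<eta> by auto
      moreover have "cmap c (x t) = cmap c (z t)" using \<epsilon>(2)[of t] that by simp
      ultimately show ?thesis using cinv_cmap[OF c(1)] by metis
    qed
    then have "ball t0 (min \<epsilon> \<eta>) \<inter> {a..b} \<subseteq> E"
      by (auto simp: E_def dist_real_def abs_minus_commute)
    then show "\<exists>e>0. ball t0 e \<inter> {a..b} \<subseteq> E" using \<epsilon>(1) \<eta>(1) by (intro exI[of _ "min \<epsilon> \<eta>"]) auto
  qed
  have "E \<noteq> {}" using s by (auto simp: E_def)
  moreover have "connected {a..b}" by simp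
  ultimately have "E = {a..b}" using cl op unfolding connected_clopen by blast
  then have "t \<in> E" using t by simp
  then show ?thesis by (simp add: E_def)
qed

text \<open>Near \<open>t0\<close> the curve coincides in the chart with a solution \<open>z\<close>
  of the extended equation on an open time interval. This \<open>z\<close> is the smooth extension
  that \<open>smooth_on\<close> demands, also when \<open>t0\<close> is an end point.\<close>

lemma integral_curve_smooth:
  assumes V: "smooth_field A V" and x: "integral_curve A V {a..b} x" and ab: "{a..b} \<subseteq> {0..1}"
  shows "smooth_curve A {a..b} x"
  unfolding smooth_curve_def
proof (intro conjI ballI)
  show "continuous_on {a..b} x" using x unfolding integral_curve_def by blast
  fix c assume c: "c \<in> A"
  show "smooth_on {s \<in> {a..b}. x s \<in> cdom c} (cmap c \<circ> x)"
    unfolding smooth_on_def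
  proof (rule ballI)
    fix t0 assume "t0 \<in> {s \<in> {a..b}. x s \<in> cdom c}"
    then have t0: "t0 \<in> {a..b}" "x t0 \<in> cdom c" by auto
    have t01: "t0 \<in> {0..1}" and y0: "cmap c (x t0) \<in> cimg c" using t0 ab by auto
    obtain W F where W: "open W" "(t0, cmap c (x t0)) \<in> W" "Cinf_on W F" and Wc: "\<And>q. q \<in> W \<Longrightarrow> snd q \<in> cimg c"
      and WV: "\<And>t y. (t, y) \<in> W \<Longrightarrow> t \<in> {0..1} \<Longrightarrow> F (t, y) = V t (cinv c y) c"
      using smooth_field_extension[OF V c t01 y0] by blast
    obtain \<eta> where \<eta>: "\<eta> > 0" "\<And>t. t \<in> {a..b} \<Longrightarrow> \<bar>t - t0\<bar> < \<eta> \<Longrightarrow> x t \<in> cdom c \<and>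
      ((cmap c \<circ> x) has_vector_derivative F (t, (cmap c \<circ> x) t)) (at t within {a..b})"
      using integral_curve_in_chart[OF V x ab t0(1) c t0(2) W(1,2) WV] by blast
    obtain e d where e: "e > 0" "d > 0" and ex: "\<And>s y. \<bar>s - t0\<bar> < d \<Longrightarrow> dist (cmap c (x t0)) y < d \<Longrightarrow>
       \<exists>z. z s = y \<and> (\<forall>t\<in>{s-e..s+e}. (t, z t) \<in> W \<and>
      (z has_vector_derivative F (t, z t)) (at t within {s-e..s+e}))"
      using ode_exists_local[OF W(1,3,2)] by blast
    obtain z where z: "z t0 = cmap c (x t0)" and zW: "\<And>t. t \<in> {t0-e..t0+e} \<Longrightarrow> (t, z t) \<in> W"
      and zd: "\<And>t. t \<in> {t0-e..t0+e} \<Longrightarrow> (z has_vector_derivative F (t, z t)) (at t within {t0-e..t0+e})"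
      using ex[of t0 "cmap c (x t0)"] e by auto
    have zd': "(z has_vector_derivative F (t, z t)) (at t)" if t: "t \<in> {t0-e<..<t0+e}" for t
      using zd[of t] t at_within_Icc_at[of "t0-e" t "t0+e"] by simp
    have zC: "Cinf_on {t0-e<..<t0+e} z"
      by (rule ode_solution_Cinf[OF _ W(3) zW zd']) auto
    have W3: "(t0, (cmap c \<circ> x) t0) \<in> W" using W(2) by simp
    have me: "min e \<eta> > 0" using e \<eta> by simp
    obtain \<epsilon> where \<epsilon>: "\<epsilon> > 0" "\<And>t. t \<in> {a..b} \<Longrightarrow> \<bar>t - t0\<bar> < \<epsilon> \<Longrightarrow> (cmap c \<circ> x) t = z t"
    proof (rule ode_unique_local[where x="cmap c \<circ> x" and z=z, OF W(1,3) W3 me t0(1)])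
      fix t assume t: "t \<in> {a..b}" "\<bar>t - t0\<bar> < min e \<eta>"
      show "((cmap c \<circ> x) has_vector_derivative F (t, (cmap c \<circ> x) t)) (at t within {a..b})"
        using \<eta>(2)[of t] t by simp
      have "t \<in> {t0-e<..<t0+e}" using t by (auto simp: abs_less_iff)
      from zd'[OF this] show "(z has_vector_derivative F (t, z t)) (at t within {a..b})"
        by (rule has_vector_derivative_at_within)
    qed (use z in auto)
    define \<delta> where "\<delta> = min e \<epsilon>"
    have \<delta>: "\<delta> > 0" "\<delta> \<le> e" "\<delta> \<le> \<epsilon>" using e \<epsilon> by (auto simp: \<delta>_def)
    show "\<exists>W g. open W \<and> t0 \<in> W \<and> Cinf_on W g \<and> (\<forall>q\<in>W \<inter> {s \<in> {a..b}. x s \<in> cdom c}. g q = (cmap c \<circ> x) q)"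
    proof (intro exI[of _ "{t0-\<delta><..<t0+\<delta>}"] exI[of _ z] conjI ballI)
      show "Cinf_on {t0-\<delta><..<t0+\<delta>} z" using zC by (rule Cinf_on_subset) (use \<delta> in auto)
      fix q assume q: "q \<in> {t0-\<delta><..<t0+\<delta>} \<inter> {s \<in> {a..b}. x s \<in> cdom c}"
      then have "q \<in> {a..b}" "\<bar>q - t0\<bar> < \<epsilon>" using \<delta> by (auto simp: abs_less_iff)
      then show "z q = (cmap c \<circ> x) q" using \<epsilon>(2) by metis
    qed (use \<delta> in auto)
  qed
qed

lemma is_solution_iff:
  assumes "smooth_field A V" "t \<in> {0..1}"
  shows "is_solution A V t x0 x \<longleftrightarrow> integral_curve A V {0..t} x \<and> x 0 = x0"
proof -
  have "{0..t} \<subseteq> {0..1}" using assms(2) by auto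
  then show ?thesis
    using integral_curve_smooth[OF assms(1), of 0 t x]
    unfolding is_solution_def integral_curve_def smooth_curve_def by blast
qed

lemma flow_eq:
  assumes V: "smooth_field A V" and t: "t \<in> {0..1}" and x: "integral_curve A V {0..t} x"
  shows "flow A V t (x 0) = x t"
  unfolding flow_def
proof (rule the_equality)
  show "\<exists>z. is_solution A V t (x 0) z \<and> x t = z t"
    using x is_solution_iff[OF V t] by blast
  fix y assume "\<exists>z. is_solution A V t (x 0) z \<and> y = z t"
  then obtain z where z: "integral_curve A V {0..t} z" "z 0 = x 0" "y = z t"
    using is_solution_iff[OF V t] by blast
  have "z t = x t"
    by (rule integral_curve_unique[OF V z(1) x _ _ z(2)]) (use t in auto)
  then show "y = x t" using z by simp
qed

section \<open>Existence and completeness\<close>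

lemma integral_curve_exists_local:
  assumes V: "smooth_field A V" and t0: "t0 \<in> {0..1}"
  obtains e N where "e > 0" "open N" "(t0, p0) \<in> N"
    "\<And>s p. (s, p) \<in> N \<Longrightarrow> s \<in> {0..1} \<Longrightarrow> \<exists>x. integral_curve A V ({s-e..s+e} \<inter> {0..1}) x \<and> x s = p"
proof -
  obtain c where c: "c \<in> A" "p0 \<in> cdom c" using chart_ex by blast
  then have y0: "cmap c p0 \<in> cimg c" by auto
  obtain W F where W: "open W" "(t0, cmap c p0) \<in> W" "Cinf_on W F" and Wc: "\<And>q. q \<in> W \<Longrightarrow> snd q \<in> cimg c"
    and WV: "\<And>t y. (t, y) \<in> W \<Longrightarrow> t \<in> {0..1} \<Longrightarrow> F (t, y) = V t (cinv c y) c"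
    using smooth_field_extension[OF V c(1) t0 y0] by blast
  obtain e d where e: "e > 0" "d > 0" and ex: "\<And>s y. \<bar>s - t0\<bar> < d \<Longrightarrow> dist (cmap c p0) y < d \<Longrightarrow>
     \<exists>z. z s = y \<and> (\<forall>t\<in>{s-e..s+e}. (t, z t) \<in> W \<and>
    (z has_vector_derivative F (t, z t)) (at t within {s-e..s+e}))"
    using ode_exists_local[OF W(1,3,2)] by blast
  define N where "N = ball t0 d \<times> (cdom c \<inter> cmap c -` ball (cmap c p0) d)"
  show ?thesis
  proof (rule that[OF e(1), of N])
    show "open N" unfolding N_def by (intro open_Times open_cmap_vimage[OF c(1)]) auto
    show "(t0, p0) \<in> N" using c e by (simp add: N_def)
    fix s p assume "(s, p) \<in> N" and s: "s \<in> {0..1}"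
    then have sp: "\<bar>s - t0\<bar> < d" "p \<in> cdom c" "dist (cmap c p0) (cmap c p) < d"
      by (auto simp: N_def dist_real_def abs_minus_commute)
    obtain z where z: "z s = cmap c p" and zW: "\<And>t. t \<in> {s-e..s+e} \<Longrightarrow> (t, z t) \<in> W"
      and zd: "\<And>t. t \<in> {s-e..s+e} \<Longrightarrow> (z has_vector_derivative F (t, z t)) (at t within {s-e..s+e})"
      using ex[OF sp(1,3)] by blast
    define I where "I = {s-e..s+e} \<inter> {0..1}"
    define x where "x = cinv c \<circ> z"
    have zc: "z t \<in> cimg c" if "t \<in> I" for t using Wc[OF zW[of t]] that by (simp add: I_def)
    have zdI: "(z has_vector_derivative F (t, z t)) (at t within I)" if "t \<in> I" for t
      using zd[of t] that unfolding I_def by (auto intro: has_vector_derivative_within_subset)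
    have cz: "continuous_on I z" by (rule continuous_on_vector_derivative[OF zdI])
    have cx: "continuous_on I x"
      unfolding x_def o_def by (rule continuous_on_compose2[OF cont_cinv[OF c(1)] cz]) (use zc in auto)
    have xc: "x t \<in> cdom c" "cmap c (x t) = z t" if "t \<in> I" for t
      using cinv_in cmap_cinv zc[OF that] by (auto simp: x_def)
    have "((cmap c' \<circ> x) has_vector_derivative V t (x t) c') (at t within I)"
      if t: "t \<in> I" and c': "c' \<in> A" "x t \<in> cdom c'" for t c'
    proof (rule has_vector_derivative_change_chart[where x=x and s=t, OF c(1) xc(1)[OF t] c' t])
      have t1: "t \<in> {0..1}" "(t, z t) \<in> W" using t zW by (auto simp: I_def)
      show "continuous (at t within I) x" using cx t by (simp add: continuous_on_eq_continuous_within)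
      show "V t (x t) \<in> tangent_space A (x t)" using smooth_field_tangent[OF V t1(1)] .
      have "(z has_vector_derivative V t (x t) c) (at t within I)"
        using zdI[OF t] WV[OF t1(2,1)] by (simp add: x_def)
      then show "((cmap c \<circ> x) has_vector_derivative V t (x t) c) (at t within I)"
        by (rule has_vector_derivative_transform[OF t, rotated]) (use xc in simp)
    qed
    then have "integral_curve A V I x" using cx unfolding integral_curve_def by blast
    moreover have "x s = p" using z cinv_cmap[OF c(1) sp(2)] by (simp add: x_def)
    ultimately show "\<exists>x. integral_curve A V ({s-e..s+e} \<inter> {0..1}) x \<and> x s = p" unfolding I_def by blast
  qed
qed

text \<open>Finitely many of the local neighbourhoods cover \<open>{0..1} \<times> K\<close>, and
  the least of their existence times works throughout. Outside \<open>K\<close> constant curves are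
  integral curves.\<close>

lemma integral_curve_exists_uniform:
  assumes V: "smooth_field A V" and K: "compact K" and V0: "\<And>t p. t \<in> {0..1} \<Longrightarrow> p \<notin> K \<Longrightarrow> V t p = (\<lambda>_. 0)"
  obtains e where "e > 0"
    "\<And>s p. s \<in> {0..1} \<Longrightarrow> \<exists>x. integral_curve A V ({s-e..s+e} \<inter> {0..1}) x \<and> x s = p"
proof -
  define G where "G e N \<longleftrightarrow> e > 0 \<and> open N \<and> (\<forall>s p. (s, p) \<in> N \<longrightarrow> s \<in> {0..1} \<longrightarrow>
     (\<exists>x. integral_curve A V ({s-e..s+e} \<inter> {0..1}) x \<and> x s = p))" for e :: real and N
  have "\<exists>e N. G e N \<and> q \<in> N" if q: "q \<in> {0..1} \<times> K" for q
  proof -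
    obtain t0 p0 where q': "q = (t0, p0)" "t0 \<in> {0..1}" using q by auto
    show ?thesis unfolding G_def q'(1)
      by (rule integral_curve_exists_local[OF V q'(2), of p0]) blast
  qed
  then obtain \<epsilon> N where N: "\<And>q. q \<in> {0..1} \<times> K \<Longrightarrow> G (\<epsilon> q) (N q) \<and> q \<in> N q" by metis
  have "compact ({0..1::real} \<times> K)" using K by (intro compact_Times) auto
  moreover have "\<And>q. q \<in> {0..1} \<times> K \<Longrightarrow> open (N q)" "{0..1} \<times> K \<subseteq> (\<Union>q\<in>{0..1} \<times> K. N q)"
    using N unfolding G_def by blast+
  ultimately obtain Q where Q: "Q \<subseteq> {0..1} \<times> K" "finite Q" "{0..1} \<times> K \<subseteq> (\<Union>q\<in>Q. N q)"
    by (rule compactE_image)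
  \<comment> \<open>The inserted 1 keeps the set nonempty when the cover is, that is, when
    \<open>K\<close> is empty.\<close>
  define e where "e = Min (insert 1 (\<epsilon> ` Q))"
  have e: "e > 0" unfolding e_def using Q N by (subst Min_gr_iff) (auto simp: G_def)
  have ele: "e \<le> \<epsilon> q" if "q \<in> Q" for q unfolding e_def using Q(2) that by (intro Min_le) auto
  show ?thesis
  proof (rule that[OF e])
    fix s :: real and p assume s: "s \<in> {0..1}"
    show "\<exists>x. integral_curve A V ({s-e..s+e} \<inter> {0..1}) x \<and> x s = p"
    proof (cases "p \<in> K")
      case True
      then obtain q where q: "q \<in> Q" "(s, p) \<in> N q" using Q(3) s by blast
      then have "G (\<epsilon> q) (N q)" using N Q(1) by blast
      then obtain x where x: "integral_curve A V ({s-\<epsilon> q..s+\<epsilon> q} \<inter> {0..1}) x" "x s = p"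
        unfolding G_def using q(2) s by blast
      have "integral_curve A V ({s-e..s+e} \<inter> {0..1}) x"
        using x(1) by (rule integral_curve_subset) (use ele[OF q(1)] in auto)
      then show ?thesis using x(2) by blast
    next
      case False
      then have "integral_curve A V ({s-e..s+e} \<inter> {0..1}) (\<lambda>_. p)"
        using V0 unfolding integral_curve_def by (auto simp: o_def)
      then show ?thesis by (intro exI[of _ "\<lambda>_. p"]) simp
    qed
  qed
qed

text \<open>Because the existence time \<open>e\<close> is the same everywhere, a curve can be
  prolonged by \<open>e\<close> at both ends until it fills \<open>{0..1}\<close>.\<close>

lemma integral_curve_exists_global:
  assumes V: "smooth_field A V" and K: "compact K" and V0: "\<And>t p. t \<in> {0..1} \<Longrightarrow> p \<notin> K \<Longrightarrow> V t p = (\<lambda>_. 0)"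
    and s: "s \<in> {0..1}"
  shows "\<exists>x. integral_curve A V {0..1} x \<and> x s = p"
proof -
  obtain e where e: "e > 0" and ex: "\<And>s p. s \<in> {0..1} \<Longrightarrow> \<exists>x. integral_curve A V ({s-e..s+e} \<inter> {0..1}) x \<and> x s = p"
    using integral_curve_exists_uniform[OF V K V0] by blast
  have step: "\<exists>x. integral_curve A V {max 0 (s - n * e)..min 1 (s + n * e)} x \<and> x s = p" for n :: nat
  proof (induction n)
    case 0
    obtain x where x: "integral_curve A V ({s-e..s+e} \<inter> {0..1}) x" "x s = p" using ex[OF s] by blast
    have "integral_curve A V {s..s} x" using x(1) by (rule integral_curve_subset) (use s e in auto)
    then show ?case using x(2) s by (auto simp: max_def min_def)
  next
    case (Suc n)
    define m where "m = n * e"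
    have m: "0 \<le> m" "Suc n * e = m + e" using e by (auto simp: m_def algebra_simps)
    define a b where "a = max 0 (s - m)" and "b = min 1 (s + m)"
    define a' b' where "a' = max 0 (s - (m + e))" and "b' = min 1 (s + (m + e))"
    have ab: "a \<in> {0..1}" "b \<in> {0..1}" "a' \<le> a" "a \<le> s" "s \<le> b" "b \<le> b'" "a - e \<le> a'" "b' \<le> b + e" "0 \<le> a'" "b' \<le> 1"
      using s e m(1) by (auto simp: a_def b_def a'_def b'_def)
    obtain x where x: "integral_curve A V {a..b} x" "x s = p" using Suc unfolding a_def b_def m_def by blast
    obtain y where y: "integral_curve A V ({b-e..b+e} \<inter> {0..1}) y" "y b = x b" using ex[OF ab(2)] by blast
    have y': "integral_curve A V {b..b'} y" using y(1) by (rule integral_curve_subset) (use ab e in auto)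
    define x1 where "x1 t = (if t \<le> b then x t else y t)" for t
    have x1: "integral_curve A V {a..b'} x1"
      unfolding x1_def by (rule integral_curve_glue[OF x(1) y']) (use y ab in auto)
    obtain z where z: "integral_curve A V ({a-e..a+e} \<inter> {0..1}) z" "z a = x1 a" using ex[OF ab(1)] by blast
    have z': "integral_curve A V {a'..a} z" using z(1) by (rule integral_curve_subset) (use ab e in auto)
    have "integral_curve A V {a'..b'} (\<lambda>t. if t \<le> a then z t else x1 t)"
      by (rule integral_curve_glue[OF z' x1]) (use z ab in auto)
    moreover have "(if s \<le> a then z s else x1 s) = p"
      using ab x z by (auto simp: x1_def)
    ultimately show ?case unfolding a'_def b'_def m(2) by blast
  qed
  obtain n :: nat where "1 < n * e" using ex_less_of_nat_mult[OF e, of 1] by blast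
  then have "max 0 (s - n * e) = 0" "min 1 (s + n * e) = 1" using s by auto
  then show ?thesis using step[of n] by simp
qed

text \<open>For surjectivity of the time-\<open>t\<close> map, take the integral curve through
  \<open>p\<close> at time \<open>t\<close>; its position at time 0 is a preimage of
  \<open>p\<close>.\<close>

lemma compatible_UNIV:
  assumes V: "smooth_field A V" and K: "compact K" and V0: "\<And>t p. t \<in> {0..1} \<Longrightarrow> p \<notin> K \<Longrightarrow> V t p = (\<lambda>_. 0)"
  shows "compatible A UNIV V"
  unfolding compatible_def
proof (intro conjI ballI)
  have "p \<in> flow_domain A V 1" for p
    using integral_curve_exists_global[OF V K V0, of 0 p] is_solution_iff[OF V, of 1 p]
    by (auto simp: flow_domain_def)
  then show "UNIV \<subseteq> flow_domain A V 1" by blast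
  fix t :: real assume t: "t \<in> {0..1}"
  have "p \<in> range (flow A V t)" for p
  proof -
    obtain x where x: "integral_curve A V {0..1} x" "x t = p"
      using integral_curve_exists_global[OF V K V0 t] by blast
    have "integral_curve A V {0..t} x" using x(1) by (rule integral_curve_subset) (use t in auto)
    from flow_eq[OF V t this] show ?thesis using x(2) by (metis rangeI)
  qed
  then show "range (flow A V t) = UNIV" by blast
qed

end

section \<open>Cutoff functions\<close>

context manifold begin

definition smooth_fun :: "('a \<Rightarrow> real) \<Rightarrow> bool" where
  "smooth_fun f \<longleftrightarrow> (\<forall>c\<in>A. Cinf_on (cimg c) (f \<circ> cinv c))"

text \<open>In a chart, \<open>flat 0\<close> of \<open>r\<^sup>2\<close> minus the squared distance
  to \<open>y0\<close> is smooth and vanishes off a ball. Extension by 0 stays smooth because the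
  compact set \<open>K\<close> is closed in a Hausdorff space.\<close>

lemma exists_bump:
  assumes U: "open U" and p: "p \<in> U"
  shows "\<exists>f K N. smooth_fun f \<and> compact K \<and> K \<subseteq> U \<and> (\<forall>q. f q \<ge> 0) \<and> (\<forall>q. q \<notin> K \<longrightarrow> f q = 0) \<and>
    open N \<and> p \<in> N \<and> (\<forall>q\<in>N. f q \<ge> 1)"
proof -
  obtain c where c: "c \<in> A" "p \<in> cdom c" using chart_ex by blast
  define y0 where "y0 = cmap c p"
  have "open (cimg c \<inter> cinv c -` U)" "y0 \<in> cimg c \<inter> cinv c -` U"
    using open_cinv_vimage[OF c(1) U] c p cinv_cmap by (auto simp: y0_def)
  then obtain r where r: "r > 0" "cball y0 r \<subseteq> cimg c \<inter> cinv c -` U" by (meson open_contains_cball)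
  \<comment> \<open>Normalises the bump to the value 2 at its centre, so that it exceeds 1 on a
    whole neighbourhood.\<close>
  define C where "C = 2 / flat 0 (r\<^sup>2)"
  have flat_pos: "flat 0 (r\<^sup>2) > 0" using r by (simp add: flat_def)
  then have C: "C > 0" by (simp add: C_def)
  define h where "h y = C * flat 0 (r\<^sup>2 + (-1) * ((y - y0) \<bullet> (y - y0)))" for y :: 'e
  have h: "Cinf_on UNIV h"
  proof -
    have "Cinf_on UNIV (\<lambda>y::'e. y + (- y0))"
      unfolding Cinf_on_def by (intro allI Ck_on_add Ck_on_ident Ck_on_const open_UNIV)
    then have "Cinf_on UNIV (\<lambda>y::'e. y - y0)" by simp
    then have "Cinf_on UNIV (\<lambda>y::'e. r\<^sup>2 + (-1) * ((y - y0) \<bullet> (y - y0)))"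
      by (intro Cinf_on_affine Cinf_on_bilinear[OF bounded_bilinear_inner] open_UNIV)
    then have "Cinf_on UNIV (\<lambda>y::'e. flat 0 (r\<^sup>2 + (-1) * ((y - y0) \<bullet> (y - y0))))"
      by (intro Cinf_on_compose[OF open_UNIV _ _ Cinf_on_flat]) auto
    then have "Cinf_on UNIV (\<lambda>y::'e. 0 + C * flat 0 (r\<^sup>2 + (-1) * ((y - y0) \<bullet> (y - y0))))"
      by (intro Cinf_on_affine open_UNIV)
    then show ?thesis by (simp add: h_def[abs_def])
  qed
  have h0: "h y = 0" if "y \<notin> cball y0 r" for y
  proof -
    have "r < norm (y - y0)" using that by (simp add: dist_norm norm_minus_commute)
    then have "r\<^sup>2 \<le> (norm (y - y0))\<^sup>2" using r by (intro power_mono) auto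
    then show ?thesis by (simp add: h_def flat_def dot_square_norm)
  qed
  have hpos: "h y \<ge> 0" for y using C by (simp add: h_def flat_def)
  have hy0: "h y0 = 2" using flat_pos by (simp add: h_def C_def)
  define K where "K = cinv c ` cball y0 r"
  have K: "compact K" unfolding K_def
    by (rule compact_continuous_image[OF continuous_on_subset[OF cont_cinv[OF c(1)]]]) (use r in auto)
  define f where "f q = (if q \<in> cdom c then h (cmap c q) else 0)" for q
  have f0: "f q = 0" if "q \<notin> K" for q
  proof (cases "q \<in> cdom c")
    case True
    then have "cmap c q \<notin> cball y0 r"
      using that cinv_cmap[OF c(1) True] unfolding K_def by force
    then show ?thesis using h0 by (simp add: f_def)
  qed (simp add: f_def)
  have KU: "K \<subseteq> U" "K \<subseteq> cdom c" using r cinv_in unfolding K_def by auto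
  have "Cinf_on (cimg d) (f \<circ> cinv d)" if d: "d \<in> A" for d
  proof (rule Cinf_on_local)
    fix y assume y: "y \<in> cimg d"
    show "\<exists>W. open W \<and> y \<in> W \<and> Cinf_on W (f \<circ> cinv d)"
    \<comment> \<open>At points of \<open>K\<close> the chart \<open>c\<close> is available and
      gives the formula for \<open>f\<close>; the other points have a neighbourhood off
      \<open>K\<close>, where \<open>f\<close> is 0.\<close>
    proof (cases "cinv d y \<in> K")
      case True
      let ?W = "cmap d ` (cdom d \<inter> cdom c)"
      have "Cinf_on ?W (\<lambda>y. h (transition d c y))"
        by (rule Cinf_on_compose[OF open_overlap[OF d c(1)] _ transition_Cinf[OF d c(1)] h]) auto
      then have "Cinf_on ?W (f \<circ> cinv d)"
        by (rule Cinf_on_cong[OF open_overlap[OF d c(1)], rotated])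
          (auto simp: f_def transition_def cinv_cmap[OF d])
      moreover have "y \<in> ?W" using y True KU(2) by (auto simp: overlap_eq[OF d] simp del: image_eqI)
      ultimately show ?thesis using open_overlap[OF d c(1)] by blast
    next
      case False
      let ?W = "cimg d \<inter> cinv d -` (- K)"
      have op: "open ?W" using K compact_imp_closed by (intro open_cinv_vimage[OF d]) auto
      have "Cinf_on ?W (f \<circ> cinv d)"
        by (rule Cinf_on_cong[OF op _ Cinf_on_const[OF op, of 0]]) (auto simp: f0)
      then show ?thesis using op y False by (intro exI[of _ ?W]) auto
    qed
  qed
  then have "smooth_fun f" by (simp add: smooth_fun_def)
  moreover have "f q \<ge> 0" for q using hpos by (simp add: f_def)
  moreover have "open {y. 1 < h y}"
    using Cinf_on_continuous_on[OF h] by (intro open_Collect_less) (auto intro: continuous_intros)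
  from open_cmap_vimage[OF c(1) this] have "open (cdom c \<inter> cmap c -` {y. 1 < h y})" .
  moreover have "p \<in> cdom c \<inter> cmap c -` {y. 1 < h y}" using c hy0 by (simp add: y0_def)
  moreover have "\<forall>q\<in>cdom c \<inter> cmap c -` {y. 1 < h y}. f q \<ge> 1" by (auto simp: f_def)
  ultimately show ?thesis using K KU(1) f0 by blast
qed

text \<open>A finite sum of bumps is only known to be at least 1 near \<open>X\<close>. It is
  composed with a smooth plateau function to become constant there, since the Hamiltonian vector
  field also sees the derivative of the cutoff.\<close>

lemma exists_cutoff:
  assumes U: "open U" and X: "compact X" "X \<subseteq> U"
  obtains \<rho> K N where "smooth_fun \<rho>" "compact K" "K \<subseteq> U" "\<And>q. q \<notin> K \<Longrightarrow> \<rho> q = 0"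
    "open N" "X \<subseteq> N" "\<And>q. q \<in> N \<Longrightarrow> \<rho> q = 1"
proof -
  have "\<exists>f K N. smooth_fun f \<and> compact K \<and> K \<subseteq> U \<and> (\<forall>q. f q \<ge> 0) \<and> (\<forall>q. q \<notin> K \<longrightarrow> f q = 0) \<and>
    open N \<and> p \<in> N \<and> (\<forall>q\<in>N. f q \<ge> 1)" if "p \<in> X" for p
    using exists_bump[OF U] that X by blast
  then obtain f K N where B: "\<And>p. p \<in> X \<Longrightarrow> smooth_fun (f p) \<and> compact (K p) \<and> K p \<subseteq> U \<and>
    (\<forall>q. f p q \<ge> 0) \<and> (\<forall>q. q \<notin> K p \<longrightarrow> f p q = 0) \<and> open (N p) \<and> p \<in> N p \<and> (\<forall>q\<in>N p. f p q \<ge> (1::real))"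
    by metis
  obtain P where P: "P \<subseteq> X" "finite P" "X \<subseteq> (\<Union>p\<in>P. N p)"
    using compactE_image[OF X(1), of X N] B by blast
  define \<sigma> where "\<sigma> q = (\<Sum>p\<in>P. f p q)" for q
  \<comment> \<open>\<open>flat 0 1 = 1 / exp 1\<close> makes this vanish where \<open>\<sigma> = 0\<close>, and it is \<open>1\<close> where \<open>\<sigma> \<ge> 1\<close>.\<close>
  define \<rho> where "\<rho> q = 1 + (- exp 1) * flat 0 (1 + (-1) * \<sigma> q)" for q
  show ?thesis
  proof (rule that)
    show "smooth_fun \<rho>" unfolding smooth_fun_def
    proof
      fix c assume c: "c \<in> A"
      note op = open_cimg[OF c]
      have "Cinf_on (cimg c) (\<lambda>y. \<Sum>p\<in>P. f p (cinv c y))"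
        by (rule Cinf_on_sum[OF op]) (use B P(1) c in \<open>auto simp: smooth_fun_def o_def\<close>)
      then have "Cinf_on (cimg c) (\<lambda>y. 1 + (-1) * \<sigma> (cinv c y))"
        unfolding \<sigma>_def by (rule Cinf_on_affine[OF op])
      then have "Cinf_on (cimg c) (\<lambda>y. flat 0 (1 + (-1) * \<sigma> (cinv c y)))"
        by (intro Cinf_on_compose[OF op _ _ Cinf_on_flat]) auto
      then show "Cinf_on (cimg c) (\<rho> \<circ> cinv c)"
        unfolding \<rho>_def o_def by (rule Cinf_on_affine[OF op])
    qed
    show "compact (\<Union>p\<in>P. K p)" using P B by (intro compact_UN) auto
    show "(\<Union>p\<in>P. K p) \<subseteq> U" using P B by blast
    show "\<rho> q = 0" if "q \<notin> (\<Union>p\<in>P. K p)" for q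
    proof -
      have "\<sigma> q = 0" unfolding \<sigma>_def using that B P by (intro sum.neutral) blast
      then show ?thesis by (simp add: \<rho>_def flat_def exp_minus)
    qed
    show "open (\<Union>p\<in>P. N p)" using P B by blast
    show "X \<subseteq> (\<Union>p\<in>P. N p)" by (rule P)
    show "\<rho> q = 1" if q: "q \<in> (\<Union>p\<in>P. N p)" for q
    proof -
      obtain p where p: "p \<in> P" "q \<in> N p" using q by blast
      have "1 \<le> f p q" using B p P by blast
      also have "\<dots> \<le> \<sigma> q" unfolding \<sigma>_def using P B p by (intro member_le_sum) auto
      finally show ?thesis by (simp add: \<rho>_def flat_def)
    qed
  qed
qed

lemma smooth_hamiltonian_cutoff:
  assumes \<rho>: "smooth_fun \<rho>" and H: "smooth_hamiltonian A H"
  shows "smooth_hamiltonian A (\<lambda>t q. \<rho> q * H t q)"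
  unfolding smooth_hamiltonian_def smooth_on_def
proof (intro ballI)
  fix c p assume c: "c \<in> A" and p: "p \<in> {0..1::real} \<times> cimg c"
  have "smooth_on ({0..1} \<times> cimg c) (\<lambda>(t, y). H t (cinv c y))"
    using H c unfolding smooth_hamiltonian_def by blast
  then obtain W g where W: "open W" "p \<in> W" "Cinf_on W g"
    and eq: "\<forall>q\<in>W \<inter> ({0..1} \<times> cimg c). g q = (\<lambda>(t, y). H t (cinv c y)) q"
    using p unfolding smooth_on_def by blast
  let ?W = "W \<inter> (UNIV \<times> cimg c)"
  have op: "open ?W" using W open_cimg[OF c] by (intro open_Int open_Times) auto
  have snd: "Cinf_on ?W (\<lambda>q. snd q)"
    unfolding Cinf_on_def using Ck_on_bounded_linear[OF bounded_linear_snd op Ck_on_ident[OF op]] by blast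
  have "Cinf_on ?W (\<lambda>q. (\<rho> \<circ> cinv c) (snd q))"
    by (rule Cinf_on_compose[OF op _ snd, of "cimg c"]) (use \<rho> c in \<open>auto simp: smooth_fun_def o_def\<close>)
  moreover have "Cinf_on ?W g" using W(3) by (rule Cinf_on_subset) auto
  ultimately have "Cinf_on ?W (\<lambda>q. (\<rho> \<circ> cinv c) (snd q) * g q)"
    by (rule Cinf_on_bilinear[OF bounded_bilinear_mult op])
  moreover have "\<forall>q\<in>?W \<inter> ({0..1} \<times> cimg c).
      (\<rho> \<circ> cinv c) (snd q) * g q = (\<lambda>(t, y). \<rho> (cinv c y) * H t (cinv c y)) q"
    using eq by auto
  ultimately show "\<exists>W g. open W \<and> p \<in> W \<and> Cinf_on W g \<and>
      (\<forall>q\<in>W \<inter> ({0..1} \<times> cimg c). g q = (\<lambda>(t, y). \<rho> (cinv c y) * H t (cinv c y)) q)"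
    using op W(2) p by (intro exI[of _ ?W] exI[of _ "\<lambda>q. (\<rho> \<circ> cinv c) (snd q) * g q"]) auto
qed

end

section \<open>Cutting off a Hamiltonian and comparing the suprema\<close>

text \<open>The support is a closure, so vanishing outside the open set \<open>U\<close> would not
  confine it to \<open>U\<close>; a closed set inside \<open>U\<close> does.\<close>

lemma ham_support_subset:
  assumes "closed K" "\<And>t x. x \<notin> K \<Longrightarrow> H t x = 0"
  shows "ham_support H \<subseteq> {0..1} \<times> K"
  unfolding ham_support_def
  by (rule closure_minimal) (use assms in \<open>auto intro: closed_Times\<close>)

context symplectic begin

lemma cutoff_hamiltonian:
  assumes U: "open U" and X: "compact X" "X \<subseteq> U" and H: "H \<in> hamiltonians A \<omega> X"
  obtains H' where "H' \<in> hamiltonians A \<omega> UNIV" "ham_support H' \<subseteq> {0..1} \<times> U"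
    "\<And>p. p \<in> X \<Longrightarrow> hflow A \<omega> H' 1 p = hflow A \<omega> H 1 p"
proof -
  obtain \<rho> K N where \<rho>: "smooth_fun \<rho>" and K: "compact K" "K \<subseteq> U" "\<And>q. q \<notin> K \<Longrightarrow> \<rho> q = 0"
    and N: "open N" "X \<subseteq> N" "\<And>q. q \<in> N \<Longrightarrow> \<rho> q = 1"
    using exists_cutoff[OF U X] by blast
  have clK: "closed K" using K(1) by (rule compact_imp_closed)
  define H' where "H' = (\<lambda>t q. \<rho> q * H t q)"
  define V where "V t = hamiltonian_vf A \<omega> (H t)" for t
  define V' where "V' t = hamiltonian_vf A \<omega> (H' t)" for t
  have sH: "smooth_hamiltonian A H" and comp: "compatible A X V"
    using H by (auto simp: hamiltonians_def V_def[abs_def])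
  have sH': "smooth_hamiltonian A H'" unfolding H'_def by (rule smooth_hamiltonian_cutoff[OF \<rho> sH])
  have sV: "smooth_field A V" and sV': "smooth_field A V'"
    using smooth_field_hamiltonian_vf[OF sH] smooth_field_hamiltonian_vf[OF sH']
    by (simp_all add: V_def[abs_def] V'_def[abs_def])
  have V'0: "V' t p = (\<lambda>_. 0)" if "p \<notin> K" for t p
    unfolding V'_def hamiltonian_vf_zero[of p, symmetric]
    by (rule hamiltonian_vf_local[of "- K"]) (use clK that K(3) in \<open>auto simp: H'_def\<close>)
  \<comment> \<open>Agreement of the Hamiltonians on \<open>X\<close> alone would not fix their
    differentials; it is used that \<open>\<rho>\<close> is 1 on the open set \<open>N\<close>
    around \<open>X\<close>.\<close>
  have V'X: "V' t p = V t p" if "p \<in> X" for t p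
    unfolding V'_def V_def by (rule hamiltonian_vf_local[OF N(1)]) (use that N in \<open>auto simp: H'_def\<close>)
  have "compatible A UNIV V'" by (rule compatible_UNIV[OF sV' K(1) V'0])
  then have "H' \<in> hamiltonians A \<omega> UNIV" using sH' by (simp add: hamiltonians_def V'_def[abs_def])
  moreover have "ham_support H' \<subseteq> {0..1} \<times> U"
    using ham_support_subset[OF clK, of H'] K(2,3) by (fastforce simp: H'_def)
  moreover have "hflow A \<omega> H' 1 p = hflow A \<omega> H 1 p" if p: "p \<in> X" for p
  proof -
    have "p \<in> flow_domain A V 1" using comp p unfolding compatible_def by blast
    then obtain x where "is_solution A V 1 p x" unfolding flow_domain_def by blast
    then have x: "integral_curve A V {0..1} x" "x 0 = p" using is_solution_iff[OF sV, of 1] by auto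
    have xX: "x t \<in> X" if t: "t \<in> {0..1}" for t
    proof -
      have "integral_curve A V {0..t} x" using x(1) by (rule integral_curve_subset) (use t in auto)
      from flow_eq[OF sV t this] have "x t = flow A V t p" using x(2) by simp
      then show ?thesis using comp t p unfolding compatible_def by blast
    qed
    then have "integral_curve A V' {0..1} x"
      using x(1) V'X unfolding integral_curve_def by simp
    then have "flow A V' 1 p = x 1" "flow A V 1 p = x 1"
      using flow_eq[OF sV', of 1 x] flow_eq[OF sV, of 1 x] x by auto
    then show ?thesis by (simp add: hflow_def V_def[abs_def] V'_def[abs_def])
  qed
  ultimately show ?thesis by (rule that)
qed

end

theorem proposition8:
  fixes A :: "('a::{t2_space,second_countable_topology}, 'e::findim_inner) chart set"
    and \<omega> :: "('a, 'e) two_form"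
    and U X :: "'a set"
  assumes "symplectic_manifold A \<omega>"
    and "open U"
    and "compact X"
    and "X \<subseteq> U"
  shows "open_diam A \<omega> U \<ge> rel_diam A \<omega> X"
proof -
  interpret symplectic A \<omega>
    using assms(1) by unfold_locales (auto simp: symplectic_manifold_def)
  show ?thesis
    unfolding rel_diam_def
  proof (rule Sup_least, clarify)
    fix \<phi> assume "\<phi> \<in> Ham A \<omega> X"
    then obtain H where H: "H \<in> hamiltonians A \<omega> X" "\<phi> = restrict (hflow A \<omega> H 1) X"
      unfolding Ham_def by blast
    obtain H' where H': "H' \<in> hamiltonians A \<omega> UNIV" "ham_support H' \<subseteq> {0..1} \<times> U"
      "\<And>p. p \<in> X \<Longrightarrow> hflow A \<omega> H' 1 p = hflow A \<omega> H 1 p"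
      using cutoff_hamiltonian[OF assms(2,3,4) H(1)] by blast
    let ?\<psi> = "hflow A \<omega> H' 1"
    \<comment> \<open>\<open>open_diam\<close> takes the norm of the plain flow map, while
      \<open>Ham\<close> consists of restricted maps; over \<open>UNIV\<close> the two
      coincide.\<close>
    have r: "restrict ?\<psi> UNIV = ?\<psi>" by auto
    have "?\<psi> \<in> Ham A \<omega> UNIV" using H'(1) r unfolding Ham_def by force
    \<comment> \<open>Off \<open>X\<close> both functions have the default value of
      \<open>restrict\<close>, so agreement on \<open>X\<close> gives equality.\<close>
    moreover have "restrict ?\<psi> X = \<phi>" using H'(3) H(2) by auto
    ultimately have "rel_hofer_norm A \<omega> X \<phi> \<le> hofer_norm A \<omega> UNIV ?\<psi>"
      unfolding rel_hofer_norm_def by (intro Inf_lower) blast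
    also have "\<dots> \<le> open_diam A \<omega> U"
      unfolding open_diam_def using H'(1,2) by (intro Sup_upper) blast
    finally show "rel_hofer_norm A \<omega> X \<phi> \<le> open_diam A \<omega> U" .
  qed
qed

end
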